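(* Let $\mu$ be a decomposable measure on $S_d$ with decomposition $\mu=\int_{\mathbb{P}^{d-1}}\mu_\zeta\,d\widehat\Sigma_d(\zeta)$ (in the sense described in the context). Then $f\mu$ is a decomposable measure for any $f\in L^1(|\mu|)$; moreover, \[ f\mu=\int_{\mathbb{P}^{d-1}} f\mu_\zeta\,d\widehat\Sigma_d(\zeta) \] in the weak sense.
   Context: $S_d$ is the unit sphere of $\mathbb{C}^d$, $d\ge1$; $M(S_d)$ is the space of complex Borel measures on $S_d$. $\mathbb{P}^{d-1}$ is the complex projective space of one-dimensional complex linear subspaces of $\mathbb{C}^d$, $\pi:S_d\to\mathbb{P}^{d-1}$ is the canonical projection, and $\widehat\Sigma_d$ is the unique probability measure on $\mathbb{P}^{d-1}$ invariant under all unitary transformations of $\mathbb{C}^d$. A measure $\mu\in M(S_d)$ is called decomposable if for $\widehat\Sigma_d$-a.e. $\zeta\in\mathbb{P}^{d-1}$ there is a measure $\mu_\zeta\in M(S_d)$ such that $\mathrm{supp}\,\mu_\zeta\subset\pi^{-1}(\zeta)$, $\int_{\mathbb{P}^{d-1}}\|\mu_\zeta\|\,d\widehat\Sigma_d(\zeta)<\infty$, and $\mu=\int_{\mathbb{P}^{d-1}}\mu_\zeta\,d\widehat\Sigma_d(\zeta)$ in the weak sense, i.e. \[ \int_{S_d} g\,d\mu=\int_{\mathbb{P}^{d-1}}\int_{S_d} g\,d\mu_\zeta\,d\widehat\Sigma_d(\zeta)\quad\text{for all } g\in C(S_d). \] Likewise, the displayed decomposition of $f\mu$ in the weak sense is the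 analogous identity with $\mu$, $\mu_\zeta$ replaced by $f\mu$, $f\mu_\zeta$. *)

theory Defs
  imports "HOL-Analysis.Analysis"
begin

section \<open>Complex measures\<close>

text \<open>
  A complex measure on the \<sigma>-algebra of \<^term>\<open>M\<close> (only \<^term>\<open>space M\<close> and \<^term>\<open>sets M\<close> matter,
  not \<^term>\<open>emeasure M\<close>) is a countably additive complex set function. Its values outside
  \<^term>\<open>sets M\<close> are irrelevant and left unconstrained.
\<close>

definition complex_measure :: "'a measure \<Rightarrow> ('a set \<Rightarrow> complex) \<Rightarrow> bool" where
  "complex_measure M \<mu> \<longleftrightarrow>
     (\<forall>A :: nat \<Rightarrow> 'a set. range A \<subseteq> sets M \<longrightarrow> disjoint_family A \<longrightarrow>
        (\<lambda>n. \<mu> (A n)) sums \<mu> (\<Union>n. A n))"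

text \<open>The total variation measure \<open>|\<mu>|\<close>; the supremum runs over the countable measurable
  partitions of \<open>E\<close>.\<close>

definition variation :: "'a measure \<Rightarrow> ('a set \<Rightarrow> complex) \<Rightarrow> 'a measure" where
  "variation M \<mu> = measure_of (space M) (sets M)
     (\<lambda>E. SUP A \<in> {A :: nat \<Rightarrow> 'a set. range A \<subseteq> sets M \<and> disjoint_family A \<and> (\<Union>n. A n) = E}.
        \<Sum>n. ennreal (norm (\<mu> (A n))))"

definition variation_norm :: "'a measure \<Rightarrow> ('a set \<Rightarrow> complex) \<Rightarrow> real" where
  "variation_norm M \<mu> = measure (variation M \<mu>) (space M)"

text \<open>The polar decomposition \<open>d\<mu> = h d|\<mu>|\<close> with \<open>|h| = 1\<close>. The function \<open>h\<close> is unique up to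
  \<open>|\<mu>|\<close>-null sets, so integrals against \<open>\<mu>\<close> do not depend on the choice.\<close>

definition polar_density :: "'a measure \<Rightarrow> ('a set \<Rightarrow> complex) \<Rightarrow> 'a \<Rightarrow> complex" where
  "polar_density M \<mu> = (SOME h. h \<in> borel_measurable M \<and> (\<forall>x\<in>space M. norm (h x) = 1) \<and>
     (\<forall>E\<in>sets M. \<mu> E = set_lebesgue_integral (variation M \<mu>) E h))"

definition cm_integral :: "'a measure \<Rightarrow> ('a set \<Rightarrow> complex) \<Rightarrow> ('a \<Rightarrow> complex) \<Rightarrow> complex" where
  "cm_integral M \<mu> f = (LINT x|variation M \<mu>. f x * polar_density M \<mu> x)"

text \<open>The measure \<open>f\<mu>\<close>, meaningful for \<open>f \<in> L\<^sup>1(|\<mu>|)\<close>, i.e. \<^term>\<open>integrable (variation M \<mu>) f\<close>.\<close>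

definition cm_density :: "'a measure \<Rightarrow> ('a \<Rightarrow> complex) \<Rightarrow> ('a set \<Rightarrow> complex) \<Rightarrow> 'a set \<Rightarrow> complex" where
  "cm_density M f \<mu> E = cm_integral M \<mu> (\<lambda>x. indicator E x * f x)"


section \<open>The sphere and complex projective space\<close>

text \<open>The norm of \<^typ>\<open>complex ^ 'd\<close> is the Hermitian one, so \<^term>\<open>sphere 0 1 :: (complex ^ 'd) set\<close> is
  the unit sphere of \<open>\<complex>\<^sup>d\<close> with \<open>d = CARD('d) \<ge> 1\<close>. The notions \<^term>\<open>vec.subspace\<close>,
  \<^term>\<open>vec.dim\<close>, \<^term>\<open>vec.span\<close> are taken over the scalar field \<open>\<complex>\<close>.\<close>

abbreviation csphere :: "(complex ^ 'd::finite) set" where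
  "csphere \<equiv> sphere 0 1"

definition sphere_borel :: "(complex ^ 'd::finite) measure" where
  "sphere_borel = restrict_space borel csphere"

definition proj_space :: "(complex ^ 'd::finite) set set" where
  "proj_space = {V. vec.subspace V \<and> vec.dim V = 1}"

definition proj_map :: "complex ^ 'd::finite \<Rightarrow> (complex ^ 'd) set" where
  "proj_map x = vec.span {x}"

text \<open>The Borel \<sigma>-algebra of the quotient topology that \<^const>\<open>proj_map\<close> induces from the sphere;
  as a measure it is the zero measure.\<close>

definition proj_borel :: "(complex ^ 'd::finite) set measure" where
  "proj_borel = sigma proj_space
     {U. U \<subseteq> proj_space \<and> openin (top_of_set csphere) {x \<in> csphere. proj_map x \<in> U}}"

definition unitary_map :: "(complex ^ 'd::finite \<Rightarrow> complex ^ 'd) \<Rightarrow> bool" where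
  "unitary_map T \<longleftrightarrow> Vector_Spaces.linear (*s) (*s) T \<and>
     (\<forall>x y. (\<Sum>i\<in>UNIV. T x $ i * cnj (T y $ i)) = (\<Sum>i\<in>UNIV. x $ i * cnj (y $ i)))"

text \<open>The property characterising the invariant probability measure of \<open>\<P>\<^sup>d\<^sup>-\<^sup>1\<close>.\<close>

definition invariant_proj_prob :: "(complex ^ 'd::finite) set measure \<Rightarrow> bool" where
  "invariant_proj_prob \<sigma> \<longleftrightarrow> sets \<sigma> = sets proj_borel \<and> emeasure \<sigma> (space \<sigma>) = 1 \<and>
     (\<forall>T. unitary_map T \<longrightarrow> distr \<sigma> proj_borel (\<lambda>V. T ` V) = \<sigma>)"


section \<open>Decomposable measures\<close>

definition sphere_measures :: "((complex ^ 'd::finite) set \<Rightarrow> complex) set" where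
  "sphere_measures = {\<mu>. complex_measure sphere_borel \<mu>}"

definition cm_support :: "((complex ^ 'd::finite) set \<Rightarrow> complex) \<Rightarrow> (complex ^ 'd) set" where
  "cm_support \<mu> = {x \<in> csphere. \<forall>U. open U \<and> x \<in> U \<longrightarrow>
     emeasure (variation sphere_borel \<mu>) (csphere \<inter> U) \<noteq> 0}"

text \<open>
  Families \<open>(\<mu>\<^sub>\<zeta>)\<close> need only be defined for \<open>\<sigma>\<close>-a.e. \<open>\<zeta>\<close>; they are encoded by total functions
  whose values on a \<open>\<sigma>\<close>-null set are arbitrary. Integrals over \<open>\<zeta>\<close> are therefore taken with
  respect to the completion of \<open>\<sigma>\<close>. Integrability is required explicitly because the Bochner
  integral of a non-integrable function is 0.
\<close>

definition weak_decomposition ::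
  "(complex ^ 'd::finite) set measure \<Rightarrow> ((complex ^ 'd) set \<Rightarrow> complex) \<Rightarrow>
    ((complex ^ 'd) set \<Rightarrow> (complex ^ 'd) set \<Rightarrow> complex) \<Rightarrow> bool" where
  "weak_decomposition \<sigma> \<mu> m \<longleftrightarrow> (\<forall>g. continuous_on csphere g \<longrightarrow>
     integrable (completion \<sigma>) (\<lambda>\<zeta>. cm_integral sphere_borel (m \<zeta>) g) \<and>
     cm_integral sphere_borel \<mu> g = (LINT \<zeta>|completion \<sigma>. cm_integral sphere_borel (m \<zeta>) g))"

definition decomposition ::
  "(complex ^ 'd::finite) set measure \<Rightarrow> ((complex ^ 'd) set \<Rightarrow> complex) \<Rightarrow>
    ((complex ^ 'd) set \<Rightarrow> (complex ^ 'd) set \<Rightarrow> complex) \<Rightarrow> bool" where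
  "decomposition \<sigma> \<mu> m \<longleftrightarrow>
     (AE \<zeta> in \<sigma>. m \<zeta> \<in> sphere_measures \<and> cm_support (m \<zeta>) \<subseteq> {x \<in> csphere. proj_map x = \<zeta>}) \<and>
     integrable (completion \<sigma>) (\<lambda>\<zeta>. variation_norm sphere_borel (m \<zeta>)) \<and>
     weak_decomposition \<sigma> \<mu> m"

definition decomposable ::
  "(complex ^ 'd::finite) set measure \<Rightarrow> ((complex ^ 'd) set \<Rightarrow> complex) \<Rightarrow> bool" where
  "decomposable \<sigma> \<mu> \<longleftrightarrow> \<mu> \<in> sphere_measures \<and> (\<exists>m. decomposition \<sigma> \<mu> m)"

end

theory Submission
  imports Defs
begin

text \<open>
  The crux is that the total variations disintegrate along with the measures:
  \<open>|\<mu>| = \<integral> |\<mu>\<^sub>\<zeta>| d\<sigma>(\<zeta>)\<close>. Let \<open>\<mu> = H |\<mu>|\<close> be the polar decomposition of \<open>\<mu>\<close>.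
  By dominated convergence the weak decomposition extends from continuous to bounded Borel functions.
  Since \<open>\<mu>\<^sub>\<zeta>\<close> lives on the fibre over \<open>\<zeta>\<close>, testing \<open>\<mu>\<close> against the conjugate of \<open>H\<close> times
  the indicator of \<open>A \<inter> \<pi>\<^sup>-\<^sup>1(B)\<close> gives
  \<open>\<integral>\<^sub>B (\<integral>\<^sub>A cnj H d\<mu>\<^sub>\<zeta>) d\<sigma>(\<zeta>) = |\<mu>|(A \<inter> \<pi>\<^sup>-\<^sup>1(B)) \<ge> 0\<close>. Running \<open>A\<close> through the finite unions of a
  countable basis, the measure \<open>cnj H \<mu>\<^sub>\<zeta>\<close> is nonnegative for a.e. \<open>\<zeta>\<close>; as \<open>|H| = 1\<close>, it must then
  be \<open>|\<mu>\<^sub>\<zeta>|\<close>. So \<open>H\<close> is a polar density of almost every \<open>\<mu>\<^sub>\<zeta>\<close>, and the claims about \<open>f \<mu>\<close> reduce to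
  Fubini for the kernel of positive measures \<open>|\<mu>\<^sub>\<zeta>|\<close>.
\<close>

subsection \<open>Hahn decomposition and densities of complex measures\<close>

text \<open>Nothing is assumed about measurability of \<open>|\<mu>\<^sub>\<zeta>|(A)\<close> in
  \<zeta>: a weak decomposition only controls integrals of fixed test functions, while the total
  variation depends nonlinearly on the measure. This obstacle shapes the proof. Once one function
  \<open>H\<close> is known to be a polar density of almost every fibre measure,
  \<open>|\<mu>\<^sub>\<zeta>|(A)\<close> becomes the integral of \<open>cnj H\<close> over
  \<open>A\<close> against \<open>\<mu>\<^sub>\<zeta>\<close>, which is linear in the measure and
  therefore measurable in \<zeta>. The exceptional null set of \<zeta> depends on the test set
  \<open>A\<close>, so only countably many \<open>A\<close> can be treated at once. Finite unions of
  basis sets suffice: they increase to any open set, and outer regularity reaches all Borel sets.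
  Positivity is also what admits an unbounded \<open>f\<close>. Dominated convergence, with the
  variation norms as majorant, extends the weak decomposition to bounded functions only; for a
  kernel of positive measures monotone convergence does the rest.\<close>

definition sigma_additive :: "'a measure \<Rightarrow> ('a set \<Rightarrow> 'b::real_normed_vector) \<Rightarrow> bool" where
  "sigma_additive M \<nu> \<longleftrightarrow>
     (\<forall>A :: nat \<Rightarrow> 'a set. range A \<subseteq> sets M \<longrightarrow> disjoint_family A \<longrightarrow>
        (\<lambda>n. \<nu> (A n)) sums \<nu> (\<Union>n. A n))"

lemma sigma_additiveD:
  assumes "sigma_additive M \<nu>" "\<And>n. A n \<in> sets M" "disjoint_family A"
  shows "(\<lambda>n. \<nu> (A n)) sums \<nu> (\<Union>n. A n)"
  using assms by (auto simp: sigma_additive_def)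

lemma sigma_additive_empty:
  assumes "sigma_additive M \<nu>"
  shows "\<nu> {} = 0"
proof -
  have "(\<lambda>n::nat. \<nu> {}) sums \<nu> {}"
    using sigma_additiveD[OF assms, of "\<lambda>_. {}"] by (simp add: disjoint_family_on_def)
  then show ?thesis
    using sums_summable summable_const_iff by blast
qed

lemma sigma_additive_Un:
  assumes "sigma_additive M \<nu>" "A \<in> sets M" "B \<in> sets M" "A \<inter> B = {}"
  shows "\<nu> (A \<union> B) = \<nu> A + \<nu> B"
proof -
  have "(\<lambda>n. \<nu> (binaryset A B n)) sums \<nu> (\<Union>n. binaryset A B n)"
    by (rule sigma_additiveD[OF assms(1)])
      (use assms in \<open>auto simp: binaryset_def disjoint_family_on_def\<close>)
  moreover have "(\<lambda>n. \<nu> (binaryset A B n)) sums (\<nu> A + \<nu> B)"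
    by (rule binaryset_sums) (rule sigma_additive_empty[OF assms(1)])
  ultimately show ?thesis
    by (simp add: UN_binaryset_eq sums_unique2)
qed

lemma sigma_additive_Diff:
  assumes "sigma_additive M \<nu>" "A \<in> sets M" "B \<in> sets M" "B \<subseteq> A"
  shows "\<nu> (A - B) = \<nu> A - \<nu> B"
proof -
  have "\<nu> ((A - B) \<union> B) = \<nu> (A - B) + \<nu> B"
    by (rule sigma_additive_Un[OF assms(1)]) (use assms in auto)
  then show ?thesis using assms(4) by (simp add: Un_absorb2)
qed

lemma sigma_additive_incseq:
  assumes "sigma_additive M \<nu>" "\<And>n. A n \<in> sets M" "incseq A"
  shows "(\<lambda>n. \<nu> (A n)) \<longlonglongrightarrow> \<nu> (\<Union>n. A n)"
proof -
  have D: "disjointed A n \<in> sets M" for n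
    using sets.range_disjointed_sets[of A M] assms(2) by auto
  have "(\<Sum>i\<le>n. \<nu> (disjointed A i)) = \<nu> (A n)" for n
  proof (induction n)
    case 0
    then show ?case by (simp add: disjointed_def)
  next
    case (Suc n)
    then show ?case
      using sigma_additive_Diff[OF assms(1), of "A (Suc n)" "A n"] assms(2) incseq_SucD[OF assms(3)]
      by (simp add: disjointed_mono[OF assms(3)])
  qed
  then show ?thesis
    using sigma_additiveD[OF assms(1) D disjoint_family_disjointed]
    by (simp add: sums_def_le UN_disjointed_eq)
qed

lemma sigma_additive_decseq:
  assumes "sigma_additive M \<nu>" "\<And>n. A n \<in> sets M" "decseq A"
  shows "(\<lambda>n. \<nu> (A n)) \<longlonglongrightarrow> \<nu> (\<Inter>n. A n)"
proof -
  have sub: "A n \<subseteq> A 0" for n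
    using decseqD[OF assms(3)] by simp
  have "(\<lambda>n. \<nu> (A 0 - A n)) \<longlonglongrightarrow> \<nu> (\<Union>n. A 0 - A n)"
    by (rule sigma_additive_incseq[OF assms(1)])
      (use assms(2,3) in \<open>auto simp: incseq_def decseq_def\<close>)
  also have "(\<Union>n. A 0 - A n) = A 0 - (\<Inter>n. A n)"
    by auto
  also have "\<nu> (A 0 - (\<Inter>n. A n)) = \<nu> (A 0) - \<nu> (\<Inter>n. A n)"
    by (rule sigma_additive_Diff[OF assms(1)]) (use assms(2) in auto)
  also have "(\<lambda>n. \<nu> (A 0 - A n)) = (\<lambda>n. \<nu> (A 0) - \<nu> (A n))"
    using sigma_additive_Diff[OF assms(1) assms(2) assms(2) sub] by auto
  finally have "(\<lambda>n. \<nu> (A 0) - \<nu> (A n)) \<longlonglongrightarrow> \<nu> (A 0) - \<nu> (\<Inter>n. A n)" .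
  from tendsto_diff[OF tendsto_const[of "\<nu> (A 0)"] this]
  show ?thesis by simp
qed

text \<open>If the values were unbounded, one could keep splitting off pieces of norm at least 1
  while the remainder stays unbounded. The pieces are disjoint, so their values would form a
  convergent series whose terms do not tend to 0.\<close>

lemma sigma_additive_bounded:
  assumes \<nu>: "sigma_additive M \<nu>"
  shows "\<exists>C. \<forall>A\<in>sets M. norm (\<nu> A) \<le> C"
proof (rule ccontr)
  define bad where "bad E \<longleftrightarrow> E \<in> sets M \<and> (\<forall>C. \<exists>A\<in>sets M. A \<subseteq> E \<and> norm (\<nu> A) > C)" for E
  assume unbounded: "\<not> ?thesis"
  have bad_space: "bad (space M)"
    unfolding bad_def
  proof (intro conjI allI)
    fix C :: real
    obtain A where "A \<in> sets M" "C < norm (\<nu> A)"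
      using unbounded by (auto simp: not_le)
    then show "\<exists>A\<in>sets M. A \<subseteq> space M \<and> norm (\<nu> A) > C"
      using sets.sets_into_space by blast
  qed simp
  have step: "\<exists>E'. bad E' \<and> E' \<subseteq> E \<and> norm (\<nu> (E - E')) \<ge> 1" if E: "bad E" for E
  proof -
    from E have [measurable]: "E \<in> sets M" by (simp add: bad_def)
    \<comment> \<open>The threshold forces both \<open>\<nu> A\<close> and
      \<open>\<nu> (E - A)\<close> to have norm at least 1, so either part may be discarded. If
      \<open>A\<close> is bad it is kept; otherwise \<open>A\<close> contributes only boundedly and
      \<open>E - A\<close> must be bad.\<close>
    obtain A where A[measurable]: "A \<in> sets M" "A \<subseteq> E" "norm (\<nu> A) > 1 + norm (\<nu> E)"
      using E unfolding bad_def by metis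
    have d: "\<nu> (E - A) = \<nu> E - \<nu> A"
      by (rule sigma_additive_Diff[OF \<nu>]) (use A in auto)
    show ?thesis
    proof (cases "bad A")
      case True
      have "norm (\<nu> A) - norm (\<nu> E) \<le> norm (\<nu> E - \<nu> A)"
        using norm_triangle_ineq2[of "\<nu> A" "\<nu> E"] by (simp add: norm_minus_commute)
      then have "1 \<le> norm (\<nu> (E - A))" using A(3) d by simp
      then show ?thesis using True A(2) by blast
    next
      case False
      then obtain C where C: "\<And>B. B \<in> sets M \<Longrightarrow> B \<subseteq> A \<Longrightarrow> norm (\<nu> B) \<le> C"
        unfolding bad_def using A(1) not_le by metis
      have "\<exists>B\<in>sets M. B \<subseteq> E - A \<and> norm (\<nu> B) > K" for K
      proof -
        obtain B where B[measurable]: "B \<in> sets M" "B \<subseteq> E" "norm (\<nu> B) > K + C"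
          using E unfolding bad_def by metis
        have "\<nu> ((B \<inter> A) \<union> (B - A)) = \<nu> (B \<inter> A) + \<nu> (B - A)"
          by (rule sigma_additive_Un[OF \<nu>]) auto
        then have "norm (\<nu> B) \<le> norm (\<nu> (B \<inter> A)) + norm (\<nu> (B - A))"
          using norm_triangle_ineq[of "\<nu> (B \<inter> A)" "\<nu> (B - A)"] by (simp add: Int_Diff_Un)
        moreover have "norm (\<nu> (B \<inter> A)) \<le> C"
          by (rule C) auto
        ultimately have "K < norm (\<nu> (B - A))"
          using B(3) by linarith
        moreover have "B - A \<in> sets M" "B - A \<subseteq> E - A"
          using B(2) by auto
        ultimately show ?thesis by blast
      qed
      then have "bad (E - A)" by (simp add: bad_def)
      moreover have "E - (E - A) = A" using A by auto
      moreover have "norm (\<nu> A) \<ge> 1"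
        using A(3) norm_ge_zero[of "\<nu> E"] by linarith
      ultimately show ?thesis by (metis Diff_subset)
    qed
  qed
  have "\<exists>F. \<forall>n::nat. bad (F n) \<and> (F (Suc n) \<subseteq> F n \<and> norm (\<nu> (F n - F (Suc n))) \<ge> 1)"
    by (rule dependent_nat_choice[where P="\<lambda>_. bad"
          and Q="\<lambda>_ E E'. E' \<subseteq> E \<and> norm (\<nu> (E - E')) \<ge> 1"])
      (use bad_space step in auto)
  then obtain F :: "nat \<Rightarrow> _" where F: "\<And>n. bad (F n)" "\<And>n. F (Suc n) \<subseteq> F n"
    "\<And>n. norm (\<nu> (F n - F (Suc n))) \<ge> 1"
    by auto
  have dec: "F n \<subseteq> F m" if "m \<le> n" for m n
    using lift_Suc_antimono_le[of F] F(2) that by auto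
  have "disjoint_family (\<lambda>n. F n - F (Suc n))"
    unfolding disjoint_family_on_def
  proof (intro ballI impI)
    fix m n :: nat assume "m \<noteq> n"
    then consider "Suc m \<le> n" | "Suc n \<le> m" by linarith
    then show "(F m - F (Suc m)) \<inter> (F n - F (Suc n)) = {}"
      by cases (auto dest: dec)
  qed
  then have "(\<lambda>n. \<nu> (F n - F (Suc n))) sums \<nu> (\<Union>n. F n - F (Suc n))"
    by (intro sigma_additiveD[OF \<nu>]) (use F(1) in \<open>auto simp: bad_def\<close>)
  then have "(\<lambda>n. \<nu> (F n - F (Suc n))) \<longlonglongrightarrow> 0"
    using sums_summable summable_LIMSEQ_zero by blast
  then have "(\<lambda>n. norm (\<nu> (F n - F (Suc n)))) \<longlonglongrightarrow> 0"
    by (rule tendsto_norm_zero)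
  then have "1 \<le> (0::real)"
    by (rule LIMSEQ_le_const) (use F(3) in auto)
  then show False by simp
qed

text \<open>\<open>P\<close> is a set at which \<open>\<nu>\<close> attains its supremum
  \<open>s\<close>, finite by boundedness. Removing a subset from \<open>P\<close> or adding a
  disjoint set cannot raise the value above \<open>s\<close>, which gives both signs.\<close>

lemma Hahn_decomposition:
  fixes \<nu> :: "'a set \<Rightarrow> real"
  assumes \<nu>: "sigma_additive M \<nu>"
  obtains P where "P \<in> sets M" "\<And>E. E \<in> sets M \<Longrightarrow> E \<subseteq> P \<Longrightarrow> 0 \<le> \<nu> E"
    "\<And>E. E \<in> sets M \<Longrightarrow> E \<inter> P = {} \<Longrightarrow> \<nu> E \<le> 0"
proof -
  define s where "s = (SUP A\<in>sets M. \<nu> A)"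
  obtain C where C: "\<And>A. A \<in> sets M \<Longrightarrow> \<bar>\<nu> A\<bar> \<le> C"
    using sigma_additive_bounded[OF \<nu>] by auto
  have bdd: "bdd_above (\<nu> ` sets M)"
    unfolding bdd_above_def by (rule exI[of _ C]) (use C in fastforce)
  have le_s: "\<nu> A \<le> s" if "A \<in> sets M" for A
    unfolding s_def by (rule cSUP_upper[OF that bdd])
  have "\<exists>A\<in>sets M. s - (1/2)^n < \<nu> A" for n
  proof -
    have ne: "sets M \<noteq> {}" by auto
    have "s - (1/2)^n < (SUP A\<in>sets M. \<nu> A)" by (simp add: s_def)
    then show ?thesis
      by (simp only: less_cSUP_iff[OF ne bdd])
  qed
  then obtain A where A[measurable]: "\<And>n. A n \<in> sets M" and As: "\<And>n. s - (1/2)^n < \<nu> (A n)"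
    by metis
  define I where "I n m = (\<Inter>k\<in>{n..n+m}. A k)" for n m
  have I[measurable]: "I n m \<in> sets M" for n m
    unfolding I_def by (rule sets.finite_INT) auto
  \<comment> \<open>The loss is the geometric sum of \<open>(1/2)^k\<close> for \<open>k\<close>
    from \<open>n\<close> to \<open>n+m\<close>, kept in closed form so that the induction closes.
    Since the union with the next set has value at most \<open>s\<close>, intersecting with it costs
    at most its own deficit.\<close>
  have Im: "\<nu> (I n m) \<ge> s - 2 * (1/2)^n + (1/2)^(n+m)" for n m
  proof (induction m)
    case 0
    then show ?case using As[of n] by (simp add: I_def)
  next
    case (Suc m)
    let ?J = "I n m" and ?A = "A (n + Suc m)"
    have e: "I n (Suc m) = ?J \<inter> ?A"
      unfolding I_def by (auto simp: atLeastAtMostSuc_conv)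
    have "\<nu> (?J \<union> (?A - ?J \<inter> ?A)) = \<nu> ?J + \<nu> (?A - ?J \<inter> ?A)"
      by (rule sigma_additive_Un[OF \<nu>]) auto
    moreover have "\<nu> (?A - ?J \<inter> ?A) = \<nu> ?A - \<nu> (?J \<inter> ?A)"
      by (rule sigma_additive_Diff[OF \<nu>]) auto
    moreover have "\<nu> (?J \<union> (?A - ?J \<inter> ?A)) \<le> s"
      by (rule le_s) auto
    ultimately show ?case
      using Suc As[of "n + Suc m"] by (simp add: e)
  qed
  define B where "B n = (\<Inter>m. I n m)" for n
  have B[measurable]: "B n \<in> sets M" for n
    unfolding B_def by auto
  have Bs: "\<nu> (B n) \<ge> s - 2 * (1/2)^n" for n
  proof -
    have "(\<lambda>m. \<nu> (I n m)) \<longlonglongrightarrow> \<nu> (B n)"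
      unfolding B_def by (rule sigma_additive_decseq[OF \<nu> I]) (auto simp: decseq_def I_def)
    then show ?thesis
    proof (rule LIMSEQ_le_const, intro exI allI impI)
      fix m :: nat
      show "s - 2 * (1/2)^n \<le> \<nu> (I n m)"
        using Im[of n m] zero_le_power[of "1/2::real" "n+m"] by linarith
    qed
  qed
  define P where "P = (\<Union>n. B n)"
  have P[measurable]: "P \<in> sets M"
    unfolding P_def by auto
  \<comment> \<open>Thus \<open>P\<close> is the limes inferior of the near-maximal sets
    \<open>A n\<close>, and the \<open>B n\<close> increase to it.\<close>
  have Beq: "B n = (\<Inter>k\<in>{n..}. A k)" for n
  proof -
    have "x \<in> A k" if *: "\<forall>m. \<forall>j\<in>{n..n+m}. x \<in> A j" "n \<le> k" for x k
      using spec[OF *(1), of "k - n"] *(2) by auto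
    then show ?thesis unfolding B_def I_def by auto
  qed
  have "(\<lambda>n. \<nu> (B n)) \<longlonglongrightarrow> \<nu> P"
    unfolding P_def by (rule sigma_additive_incseq[OF \<nu> B]) (auto simp: incseq_def Beq)
  moreover have "(\<lambda>n. s - 2 * (1/2)^n) \<longlonglongrightarrow> s - 2 * 0"
    by (intro tendsto_intros) (simp add: LIMSEQ_power_zero)
  ultimately have "s - 2 * 0 \<le> \<nu> P"
    using Bs by (intro LIMSEQ_le[of "\<lambda>n. s - 2 * (1/2)^n" _ "\<lambda>n. \<nu> (B n)"]) auto
  then have sP: "\<nu> P = s" using le_s[OF P] by simp
  show ?thesis
  proof (rule that[OF P])
    fix E assume E[measurable]: "E \<in> sets M" "E \<subseteq> P"
    have "\<nu> (P - E) \<le> s" by (rule le_s) auto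
    then show "0 \<le> \<nu> E" using sigma_additive_Diff[OF \<nu> P E(1,2)] sP by simp
  next
    fix E assume E[measurable]: "E \<in> sets M" "E \<inter> P = {}"
    have "\<nu> (E \<union> P) \<le> s" by (rule le_s) auto
    then show "\<nu> E \<le> 0" using sigma_additive_Un[OF \<nu> E(1) P E(2)] sP by simp
  qed
qed

section \<open>Domination by positive measures and Radon-Nikodym densities\<close>

lemma sigma_additive_measure:
  fixes \<nu> :: "'a set \<Rightarrow> real"
  assumes \<nu>: "sigma_additive M \<nu>" and nonneg: "\<And>E. E \<in> sets M \<Longrightarrow> 0 \<le> \<nu> E"
  obtains N where "sets N = sets M" "finite_measure N"
    "\<And>E. E \<in> sets M \<Longrightarrow> measure N E = \<nu> E"
proof -
  define N where "N = measure_of (space M) (sets M) (\<lambda>E. ennreal (\<nu> E))"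
  have sN: "sets N = sets M" "space N = space M" by (simp_all add: N_def)
  have em: "emeasure N E = ennreal (\<nu> E)" if "E \<in> sets M" for E
    unfolding N_def
  proof (rule emeasure_measure_of_sigma)
    show "sigma_algebra (space M) (sets M)" ..
    show "positive (sets M) (\<lambda>E. ennreal (\<nu> E))"
      by (simp add: positive_def sigma_additive_empty[OF \<nu>])
    show "countably_additive (sets M) (\<lambda>E. ennreal (\<nu> E))"
    proof (rule countably_additiveI)
      fix A :: "nat \<Rightarrow> 'a set"
      assume A: "range A \<subseteq> sets M" "disjoint_family A"
      have "(\<lambda>i. \<nu> (A i)) sums \<nu> (\<Union>i. A i)"
        by (rule sigma_additiveD[OF \<nu>]) (use A in auto)
      then show "(\<Sum>i. ennreal (\<nu> (A i))) = ennreal (\<nu> (\<Union>i. A i))"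
        using A nonneg by (intro suminf_ennreal_eq) auto
    qed
  qed fact
  show ?thesis
  proof (rule that[OF sN(1)])
    show "finite_measure N" by (rule finite_measureI) (simp add: em sN)
    show "measure N E = \<nu> E" if "E \<in> sets M" for E
      using em[OF that] nonneg[OF that] by (simp add: measure_def)
  qed
qed

lemma sigma_additive_restrict:
  assumes "sigma_additive M \<nu>" "P \<in> sets M"
  shows "sigma_additive M (\<lambda>E. \<nu> (E \<inter> P))"
  unfolding sigma_additive_def
proof (intro allI impI)
  fix A :: "nat \<Rightarrow> _" assume A: "range A \<subseteq> sets M" "disjoint_family A"
  have "(\<lambda>n. \<nu> (A n \<inter> P)) sums \<nu> (\<Union>n. A n \<inter> P)"
    by (rule sigma_additiveD[OF assms(1)]) (use A assms(2) in \<open>auto simp: disjoint_family_on_def\<close>)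
  then show "(\<lambda>n. \<nu> (A n \<inter> P)) sums \<nu> ((\<Union>n. A n) \<inter> P)"
    by simp
qed

lemma sigma_additive_add:
  assumes "sigma_additive M \<nu>" "sigma_additive M \<nu>'"
  shows "sigma_additive M (\<lambda>E. \<nu> E + \<nu>' E)"
  using assms unfolding sigma_additive_def by (auto intro!: sums_add)

lemma sigma_additive_diff:
  assumes "sigma_additive M \<nu>" "sigma_additive M \<nu>'"
  shows "sigma_additive M (\<lambda>E. \<nu> E - \<nu>' E)"
  using assms unfolding sigma_additive_def by (auto intro!: sums_diff)

text \<open>\<open>\<tau>\<close> is the Jordan total variation, the positive part plus the negative
  part with respect to a Hahn set.\<close>

lemma sigma_additive_dominated:
  fixes \<nu> :: "'a set \<Rightarrow> real"
  assumes \<nu>: "sigma_additive M \<nu>"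
  obtains \<tau> :: "'a set \<Rightarrow> real" where "sigma_additive M \<tau>" "\<And>E. E \<in> sets M \<Longrightarrow> \<bar>\<nu> E\<bar> \<le> \<tau> E"
proof -
  obtain P where P[measurable]: "P \<in> sets M" "\<And>E. E \<in> sets M \<Longrightarrow> E \<subseteq> P \<Longrightarrow> 0 \<le> \<nu> E"
    "\<And>E. E \<in> sets M \<Longrightarrow> E \<inter> P = {} \<Longrightarrow> \<nu> E \<le> 0"
    using Hahn_decomposition[OF \<nu>] by blast
  define \<tau> where "\<tau> E = \<nu> (E \<inter> P) - \<nu> (E \<inter> (space M - P))" for E
  have "sigma_additive M \<tau>"
    unfolding \<tau>_def by (intro sigma_additive_diff sigma_additive_restrict \<nu>) auto
  moreover have "\<bar>\<nu> E\<bar> \<le> \<tau> E" if E[measurable]: "E \<in> sets M" for E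
  proof -
    have "\<nu> ((E \<inter> P) \<union> (E \<inter> (space M - P))) = \<nu> (E \<inter> P) + \<nu> (E \<inter> (space M - P))"
      by (rule sigma_additive_Un[OF \<nu>]) auto
    moreover have "(E \<inter> P) \<union> (E \<inter> (space M - P)) = E"
      using sets.sets_into_space[OF E] by auto
    moreover have "0 \<le> \<nu> (E \<inter> P)" by (rule P(2)) auto
    moreover have "\<nu> (E \<inter> (space M - P)) \<le> 0" by (rule P(3)) auto
    ultimately show ?thesis by (simp add: \<tau>_def)
  qed
  ultimately show ?thesis by (rule that[of \<tau>])
qed

lemma sigma_additive_of_measure:
  assumes "finite_measure N" "sets N = sets M"
  shows "sigma_additive M (measure N)"
proof -
  interpret finite_measure N by fact
  show ?thesis
    unfolding sigma_additive_def using assms(2) by (auto intro!: finite_measure_UNION)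
qed

text \<open>Domination makes \<open>N + \<nu>\<close> a nonnegative finite measure that vanishes on
  the null sets of \<open>N\<close>. The Radon-Nikodym theorem for positive measures gives it a
  density, and subtracting the constant density 1 of \<open>N\<close> recovers
  \<open>\<nu>\<close>.\<close>

lemma sigma_additive_density:
  fixes \<nu> :: "'a set \<Rightarrow> real"
  assumes \<nu>: "sigma_additive M \<nu>" and N: "finite_measure N" "sets N = sets M"
    and le: "\<And>E. E \<in> sets M \<Longrightarrow> \<bar>\<nu> E\<bar> \<le> measure N E"
  obtains d :: "'a \<Rightarrow> real" where "integrable N d"
    "\<And>E. E \<in> sets M \<Longrightarrow> \<nu> E = set_lebesgue_integral N E d"
proof -
  interpret N: finite_measure N by fact
  have sa: "sigma_additive M (\<lambda>E. measure N E + \<nu> E)"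
    by (intro sigma_additive_add sigma_additive_of_measure N \<nu>)
  obtain L where L: "sets L = sets M" "finite_measure L"
    "\<And>E. E \<in> sets M \<Longrightarrow> measure L E = measure N E + \<nu> E"
    by (rule sigma_additive_measure[OF sa]) (use le in force)+
  interpret L: finite_measure L by fact
  have ac: "absolutely_continuous N L"
    unfolding absolutely_continuous_def
  proof (rule subsetI)
    fix E assume "E \<in> null_sets N"
    then have "E \<in> sets M" "measure N E = 0"
      by (auto simp: N(2) measure_def)
    then show "E \<in> null_sets L"
      using le[of E] L by (auto simp: L.emeasure_eq_measure)
  qed
  have sLN: "sets L = sets N" using L(1) N(2) by simp
  obtain D where D: "D \<in> borel_measurable N" "AE x in N. RN_deriv N L x = ennreal (D x)" "\<And>x. 0 \<le> D x"
    using N.real_RN_deriv[OF L(2) ac sLN] by blast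
  have "L = density N (RN_deriv N L)"
    using N.density_RN_deriv[OF ac] L(1) N(2) by simp
  also have "\<dots> = density N D"
    by (rule density_cong) (use D in auto)
  finally have LD: "L = density N D" .
  have int: "integrable N D"
  proof (rule integrableI_nonneg)
    have "(\<integral>\<^sup>+ x. ennreal (D x) \<partial>N) = emeasure L (space N)"
      using D by (simp add: LD emeasure_density cong: nn_integral_cong)
    then show "(\<integral>\<^sup>+ x. ennreal (D x) \<partial>N) < \<infinity>"
      by (simp add: less_top[symmetric])
  qed (use D in auto)
  have LE: "measure L E = set_lebesgue_integral N E D" if E: "E \<in> sets M" for E
  proof -
    have "measure L E = integral\<^sup>L L (indicator E)"
      using E L(1) by simp
    also have "\<dots> = (\<integral>x. D x *\<^sub>R indicator E x \<partial>N)"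
      unfolding LD using D E N by (intro integral_density) auto
    finally show ?thesis by (simp add: set_lebesgue_integral_def mult.commute)
  qed
  show ?thesis
  proof (rule that[of "\<lambda>x. D x - 1"])
    show "integrable N (\<lambda>x. D x - 1)" using int by simp
    fix E assume E: "E \<in> sets M"
    have "set_lebesgue_integral N E (\<lambda>x. D x - 1) = set_lebesgue_integral N E D - set_lebesgue_integral N E (\<lambda>x. 1)"
      by (rule set_integral_diff)
        (use int E N in \<open>auto simp: set_integrable_def simp del: real_scaleR_def intro!: integrable_mult_indicator\<close>)
    also have "set_lebesgue_integral N E (\<lambda>x. 1::real) = measure N E"
      using E N by (simp add: set_lebesgue_integral_def)
    finally show "\<nu> E = set_lebesgue_integral N E (\<lambda>x. D x - 1)"
      using LE[OF E] L(3)[OF E] by simp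
  qed
qed

text \<open>The sum of the Jordan variations of the real and imaginary parts dominates both parts,
  so one \<open>N\<close> carries both densities. \<open>N\<close> need not be the total variation;
  this representation is the starting point for computing it.\<close>

lemma complex_measure_density:
  assumes \<mu>: "complex_measure M \<mu>"
  obtains N h where "finite_measure N" "sets N = sets M" "integrable N h"
    "\<And>E. E \<in> sets M \<Longrightarrow> \<mu> E = set_lebesgue_integral N E h"
proof -
  have Re: "sigma_additive M (\<lambda>E. Re (\<mu> E))" and Im: "sigma_additive M (\<lambda>E. Im (\<mu> E))"
    using \<mu> unfolding complex_measure_def sigma_additive_def by (auto intro: sums_Re sums_Im)
  obtain \<tau>1 where \<tau>1: "sigma_additive M \<tau>1" "\<And>E. E \<in> sets M \<Longrightarrow> \<bar>Re (\<mu> E)\<bar> \<le> \<tau>1 E"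
    using sigma_additive_dominated[OF Re] by blast
  obtain \<tau>2 where \<tau>2: "sigma_additive M \<tau>2" "\<And>E. E \<in> sets M \<Longrightarrow> \<bar>Im (\<mu> E)\<bar> \<le> \<tau>2 E"
    using sigma_additive_dominated[OF Im] by blast
  note \<tau> = \<tau>1 \<tau>2
  have pos: "0 \<le> \<tau>1 E" "0 \<le> \<tau>2 E" if "E \<in> sets M" for E
    using \<tau>(2)[OF that] \<tau>(4)[OF that] by linarith+
  obtain N where N: "sets N = sets M" "finite_measure N"
    "\<And>E. E \<in> sets M \<Longrightarrow> measure N E = \<tau>1 E + \<tau>2 E"
    by (rule sigma_additive_measure[OF sigma_additive_add[OF \<tau>(1,3)]]) (use pos in auto)
  have le: "\<bar>Re (\<mu> E)\<bar> \<le> measure N E" "\<bar>Im (\<mu> E)\<bar> \<le> measure N E" if "E \<in> sets M" for E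
    using \<tau>(2)[OF that] \<tau>(4)[OF that] pos[OF that] N(3)[OF that] by linarith+
  obtain d1 where d1: "integrable N d1" "\<And>E. E \<in> sets M \<Longrightarrow> Re (\<mu> E) = set_lebesgue_integral N E d1"
    using sigma_additive_density[OF Re N(2,1) le(1)] by blast
  obtain d2 where d2: "integrable N d2" "\<And>E. E \<in> sets M \<Longrightarrow> Im (\<mu> E) = set_lebesgue_integral N E d2"
    using sigma_additive_density[OF Im N(2,1) le(2)] by blast
  show ?thesis
  proof (rule that[OF N(2,1)])
    let ?h = "\<lambda>x. Complex (d1 x) (d2 x)"
    have h: "?h = (\<lambda>x. of_real (d1 x) + \<i> * of_real (d2 x))"
      by (simp add: fun_eq_iff complex_eq_iff)
    show int: "integrable N ?h"
      unfolding h using d1 d2 by auto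
    fix E assume E: "E \<in> sets M"
    have i: "integrable N (\<lambda>x. indicator E x *\<^sub>R ?h x)"
      by (rule integrable_mult_indicator) (use E N int in auto)
    have "Re (set_lebesgue_integral N E ?h) = Re (\<mu> E)" "Im (set_lebesgue_integral N E ?h) = Im (\<mu> E)"
      using d1(2)[OF E] d2(2)[OF E] i
      by (simp_all add: set_lebesgue_integral_def flip: integral_Re integral_Im)
    then show "\<mu> E = set_lebesgue_integral N E ?h"
      by (simp add: complex_eq_iff)
  qed
qed

subsection \<open>Total variation and polar decomposition\<close>

text \<open>On the set where \<open>f\<close> is negative the integral is at most 0, and by
  hypothesis at least 0; hence it vanishes and the set is null.\<close>

lemma AE_nonneg_of_set_integral:
  fixes f :: "'a \<Rightarrow> real"
  assumes f[measurable]: "integrable M f"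
    and nonneg: "\<And>E. E \<in> sets M \<Longrightarrow> 0 \<le> set_lebesgue_integral M E f"
  shows "AE x in M. 0 \<le> f x"
proof -
  define E where "E = {x\<in>space M. f x < 0}"
  have E[measurable]: "E \<in> sets M" unfolding E_def by measurable
  let ?g = "\<lambda>x. - (indicator E x *\<^sub>R f x)"
  have g: "integrable M ?g"
    by (intro Bochner_Integration.integrable_minus integrable_mult_indicator E f)
  have nn: "AE x in M. 0 \<le> ?g x"
    by (auto simp: E_def indicator_def)
  have "integral\<^sup>L M ?g = - set_lebesgue_integral M E f"
    by (simp add: set_lebesgue_integral_def)
  then have "integral\<^sup>L M ?g = 0"
    using nonneg[OF E] integral_nonneg_AE[OF nn] by linarith
  then have "AE x in M. ?g x = 0"
    using integral_nonneg_eq_0_iff_AE[OF g nn] by simp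
  then show ?thesis
    using AE_space by eventually_elim (auto simp: E_def indicator_def split: if_splits)
qed

lemma AE_nonneg_complex_of_set_integral:
  fixes f :: "'a \<Rightarrow> complex"
  assumes f: "integrable M f"
    and nonneg: "\<And>E. E \<in> sets M \<Longrightarrow> 0 \<le> Re (set_lebesgue_integral M E f) \<and> Im (set_lebesgue_integral M E f) = 0"
  shows "AE x in M. 0 \<le> Re (f x) \<and> Im (f x) = 0"
proof -
  have ReE: "Re (set_lebesgue_integral M E f) = set_lebesgue_integral M E (\<lambda>x. Re (f x))"
    and ImE: "Im (set_lebesgue_integral M E f) = set_lebesgue_integral M E (\<lambda>x. Im (f x))"
    if "E \<in> sets M" for E
    using integrable_mult_indicator[OF that f]
    by (simp_all add: set_lebesgue_integral_def flip: integral_Re integral_Im)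
  have "AE x in M. 0 \<le> Re (f x)"
    by (rule AE_nonneg_of_set_integral) (use f nonneg ReE in auto)
  moreover have "AE x in M. 0 \<le> Im (f x)"
    by (rule AE_nonneg_of_set_integral) (use f nonneg ImE in auto)
  moreover have "AE x in M. 0 \<le> - Im (f x)"
    by (rule AE_nonneg_of_set_integral) (use f nonneg ImE in \<open>auto simp: set_lebesgue_integral_def\<close>)
  ultimately show ?thesis by eventually_elim auto
qed

lemma AE_eq_of_set_integral:
  fixes f g :: "'a \<Rightarrow> complex"
  assumes f: "integrable M f" and g: "integrable M g"
    and eq: "\<And>E. E \<in> sets M \<Longrightarrow> set_lebesgue_integral M E f = set_lebesgue_integral M E g"
  shows "AE x in M. f x = g x"
proof -
  have i: "set_integrable M E f" "set_integrable M E g" if "E \<in> sets M" for E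
    unfolding set_integrable_def using that f g by (auto intro: integrable_mult_indicator)
  have "AE x in M. 0 \<le> Re (f x - g x) \<and> Im (f x - g x) = 0"
    by (rule AE_nonneg_complex_of_set_integral) (use f g i eq in \<open>auto simp: set_integral_diff\<close>)
  moreover have "AE x in M. 0 \<le> Re (g x - f x) \<and> Im (g x - f x) = 0"
    by (rule AE_nonneg_complex_of_set_integral) (use f g i eq in \<open>auto simp: set_integral_diff\<close>)
  ultimately show ?thesis by eventually_elim (simp add: complex_eq_iff)
qed

lemma set_integral_sums:
  fixes h :: "'a \<Rightarrow> 'b::{banach, second_countable_topology}"
  assumes h: "integrable N h" and A: "\<And>n::nat. A n \<in> sets N" "disjoint_family A"
  shows "(\<lambda>n. set_lebesgue_integral N (A n) h) sums set_lebesgue_integral N (\<Union>n. A n) h"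
proof -
  have si: "set_integrable N E h" if "E \<in> sets N" for E
    unfolding set_integrable_def by (rule integrable_mult_indicator[OF that h])
  have "(\<lambda>n. set_lebesgue_integral N (\<Union>i<n. A i) h) \<longlonglongrightarrow> set_lebesgue_integral N (\<Union>n. \<Union>i<n. A i) h"
    by (rule set_integral_cont_up) (use A in \<open>force simp: incseq_def intro!: si\<close>)+
  moreover have "set_lebesgue_integral N (\<Union>i<n. A i) h = (\<Sum>i<n. set_lebesgue_integral N (A i) h)" for n
    by (rule set_integral_finite_Union)
      (use A in \<open>auto intro!: si simp: disjoint_family_on_def\<close>)
  moreover have "(\<Union>n. \<Union>i<n. A i) = (\<Union>n. A n)"
    by auto
  ultimately show ?thesis by (simp add: sums_def)
qed

lemma complex_measure_of_density:
  assumes "integrable N h" "sets N = sets M"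
    "\<And>E. E \<in> sets M \<Longrightarrow> \<nu> E = set_lebesgue_integral N E h"
  shows "complex_measure M \<nu>"
  unfolding complex_measure_def
proof (intro allI impI)
  fix A :: "nat \<Rightarrow> _" assume A: "range A \<subseteq> sets M" "disjoint_family A"
  have "(\<lambda>n. set_lebesgue_integral N (A n) h) sums set_lebesgue_integral N (\<Union>n. A n) h"
    by (rule set_integral_sums) (use A assms in auto)
  moreover have "\<nu> (A n) = set_lebesgue_integral N (A n) h" for n
    using A by (intro assms(3)) auto
  moreover have "\<nu> (\<Union>n. A n) = set_lebesgue_integral N (\<Union>n. A n) h"
    using A by (intro assms(3)) auto
  ultimately show "(\<lambda>n. \<nu> (A n)) sums \<nu> (\<Union>n. A n)" by simp
qed

text \<open>Cutting a set into countably many pieces on which \<open>h\<close> oscillates little gives the lower bound of the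
  total variation.\<close>

lemma norm_set_integral_lower:
  fixes h :: "'a \<Rightarrow> complex"
  assumes N: "finite_measure N" and h: "integrable N h" and A: "A \<in> sets N"
    and osc: "\<And>x y. x \<in> A \<Longrightarrow> y \<in> A \<Longrightarrow> norm (h x - h y) \<le> r"
  shows "set_lebesgue_integral N A (\<lambda>x. norm (h x)) \<le> norm (set_lebesgue_integral N A h) + 2 * r * measure N A"
proof (cases "A = {}")
  case True
  then show ?thesis by (simp add: set_lebesgue_integral_def)
next
  case False
  then obtain y where y: "y \<in> A" by auto
  interpret finite_measure N by fact
  have si: "set_integrable N A k" if "integrable N k" for k :: "'a \<Rightarrow> 'c::{banach, second_countable_topology}"
    unfolding set_integrable_def by (rule integrable_mult_indicator[OF A that])
  \<comment> \<open>Both the integral of \<open>norm h\<close> and the norm of the integral of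
    \<open>h\<close> are compared with the constant \<open>h y\<close>. Each comparison costs
    \<open>r * measure N A\<close>, hence the factor 2.\<close>
  have "set_lebesgue_integral N A (\<lambda>x. norm (h x)) \<le> set_lebesgue_integral N A (\<lambda>x. norm (h y) + r)"
  proof (rule set_integral_mono)
    fix x assume "x \<in> A"
    then show "norm (h x) \<le> norm (h y) + r"
      using osc[of x y] y norm_triangle_sub[of "h x" "h y"] by linarith
  qed (auto intro!: si h)
  also have "\<dots> = measure N A * (norm (h y) + r)"
    using A by (simp add: set_lebesgue_integral_def)
  finally have 1: "set_lebesgue_integral N A (\<lambda>x. norm (h x)) \<le> measure N A * (norm (h y) + r)" .
  have "set_lebesgue_integral N A (\<lambda>x. h y - h x) = measure N A * h y - set_lebesgue_integral N A h"
    using A by (subst set_integral_diff)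
      (auto intro!: si h simp: set_lebesgue_integral_def scaleR_conv_of_real)
  moreover have "norm (set_lebesgue_integral N A (\<lambda>x. h y - h x)) \<le> set_lebesgue_integral N A (\<lambda>x. norm (h y - h x))"
    by (rule set_integral_norm_bound) (auto intro!: si h)
  moreover have "set_lebesgue_integral N A (\<lambda>x. norm (h y - h x)) \<le> set_lebesgue_integral N A (\<lambda>x. r)"
    by (rule set_integral_mono) (use osc y in \<open>auto intro!: si h\<close>)
  moreover have "set_lebesgue_integral N A (\<lambda>x. r) = measure N A * r"
    using A by (simp add: set_lebesgue_integral_def)
  ultimately have "norm (measure N A * h y - set_lebesgue_integral N A h) \<le> measure N A * r"
    by simp
  moreover have "norm (measure N A * h y) \<le> norm (set_lebesgue_integral N A h) + norm (measure N A * h y - set_lebesgue_integral N A h)"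
    using norm_triangle_sub by blast
  moreover have "norm (measure N A * h y) = measure N A * norm (h y)"
    by (simp add: norm_mult)
  ultimately show ?thesis using 1 by (simp add: algebra_simps)
qed

text \<open>The triangle inequality on each piece bounds every partition sum from above. Conversely,
  a partition into preimages of small squares under \<open>h\<close> makes the partition sum almost
  as large as the integral of \<open>norm h\<close>.\<close>

lemma variation_density:
  fixes h :: "'a \<Rightarrow> complex"
  assumes N: "finite_measure N" "sets N = sets M" and h: "integrable N h"
    and \<nu>: "\<And>E. E \<in> sets M \<Longrightarrow> \<nu> E = set_lebesgue_integral N E h"
  shows "variation M \<nu> = density N (\<lambda>x. ennreal (norm (h x)))"
proof -
  interpret finite_measure N by fact
  let ?D = "density N (\<lambda>x. ennreal (norm (h x)))"
  have [measurable]: "h \<in> borel_measurable N" using h by auto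
  have sp: "space N = space M" using N(2) by (rule sets_eq_imp_space_eq)
  define part where "part E = {A :: nat \<Rightarrow> 'a set. range A \<subseteq> sets M \<and> disjoint_family A \<and> (\<Union>n. A n) = E}" for E
  define V where "V E = (SUP A \<in> part E. \<Sum>n. ennreal (norm (\<nu> (A n))))" for E
  have si: "set_integrable N E k" if "E \<in> sets M" "integrable N k"
    for E and k :: "'a \<Rightarrow> 'c::{banach, second_countable_topology}"
    unfolding set_integrable_def by (rule integrable_mult_indicator) (use that N in simp_all)
  have D: "emeasure ?D E = ennreal (set_lebesgue_integral N E (\<lambda>x. norm (h x)))" if E: "E \<in> sets M" for E
  proof -
    have "emeasure ?D E = (\<integral>\<^sup>+ x. ennreal (indicator E x *\<^sub>R norm (h x)) \<partial>N)"
    proof -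
      have "E \<in> sets N" using E N by simp
      then have "emeasure ?D E = (\<integral>\<^sup>+ x. ennreal (norm (h x)) * indicator E x \<partial>N)"
        by (intro emeasure_density) measurable
      also have "\<dots> = (\<integral>\<^sup>+ x. ennreal (indicator E x *\<^sub>R norm (h x)) \<partial>N)"
        by (intro nn_integral_cong) (simp add: indicator_def)
      finally show ?thesis .
    qed
    also have "\<dots> = ennreal (set_lebesgue_integral N E (\<lambda>x. norm (h x)))"
      unfolding set_lebesgue_integral_def
      by (rule nn_integral_eq_integral) (use si[OF E integrable_norm[OF h]] in \<open>simp_all add: set_integrable_def\<close>)
    finally show ?thesis .
  qed
  have le: "ennreal (norm (\<nu> E)) \<le> emeasure ?D E" if E: "E \<in> sets M" for E
    using set_integral_norm_bound[OF si[OF E h]] D[OF E] \<nu>[OF E] by (simp add: ennreal_leI)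
  have "V E = emeasure ?D E" if E: "E \<in> sets M" for E
  proof (rule antisym)
    show "V E \<le> emeasure ?D E"
      unfolding V_def
    proof (rule SUP_least)
      fix A assume A: "A \<in> part E"
      then have A': "A n \<in> sets M" for n by (auto simp: part_def)
      have "(\<Sum>n. ennreal (norm (\<nu> (A n)))) \<le> (\<Sum>n. emeasure ?D (A n))"
        by (intro suminf_le le A') auto
      also have "\<dots> = emeasure ?D (\<Union>n. A n)"
        by (rule suminf_emeasure) (use A N in \<open>auto simp: part_def\<close>)
      finally show "(\<Sum>n. ennreal (norm (\<nu> (A n)))) \<le> emeasure ?D E"
        using A by (simp add: part_def)
    qed
    show "emeasure ?D E \<le> V E"
    proof (rule ennreal_le_epsilon)
      fix e :: real assume e: "0 < e"
      define K where "K = measure N (space N)"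
      have K: "0 \<le> K" by (simp add: K_def)
      \<comment> \<open>Chosen so that the total error \<open>4 * r * measure N E\<close> is at most
        \<open>e\<close>; the summand 1 keeps the denominator positive when \<open>N\<close> is
        zero.\<close>
      define r where "r = e / (4 * (K + 1))"
      have r: "0 < r" using e K by (simp add: r_def)
      \<comment> \<open>\<open>c x\<close> numbers the square of side \<open>r\<close> in the grid
        of the complex plane that contains \<open>h x\<close>. Numbers belonging to no square that
        is met give empty cells.\<close>
      define c where "c x = to_nat (\<lfloor>Re (h x) / r\<rfloor>, \<lfloor>Im (h x) / r\<rfloor>)" for x
      have [measurable]: "c \<in> measurable N (count_space UNIV)"
        unfolding c_def by measurable
      define A where "A k = {x \<in> space N. c x = k} \<inter> E" for k
      have A[measurable]: "A k \<in> sets M" for k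
      proof -
        have "{x \<in> space N. c x = k} \<in> sets N" by measurable
        then show ?thesis using E N(2) by (auto simp: A_def)
      qed
      have "(\<Union>k. A k) = E"
        using sets.sets_into_space[OF E] by (auto simp: A_def sp)
      then have Ap: "A \<in> part E"
        using A by (auto simp: part_def disjoint_family_on_def A_def)
      have fl: "\<bar>s - t\<bar> \<le> r" if "\<lfloor>s / r\<rfloor> = \<lfloor>t / r\<rfloor>" for s t :: real
      proof -
        have "\<bar>s / r - t / r\<bar> \<le> 1" using that by linarith
        then have "\<bar>s - t\<bar> / r \<le> 1" using r by (simp flip: diff_divide_distrib)
        then show ?thesis using r by (simp add: divide_le_eq)
      qed
      have osc: "norm (h x - h y) \<le> 2 * r" if "x \<in> A k" "y \<in> A k" for x y k
      proof -
        have "c x = c y" using that by (auto simp: A_def)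
        then have "\<bar>Re (h x) - Re (h y)\<bar> \<le> r" "\<bar>Im (h x) - Im (h y)\<bar> \<le> r"
          using fl by (auto simp: c_def)
        then show ?thesis using cmod_le[of "h x - h y"] by simp
      qed
      have cell: "emeasure ?D (A k) \<le> ennreal (norm (\<nu> (A k))) + ennreal (4 * r) * emeasure N (A k)" for k
      proof -
        \<comment> \<open>Within a cell each coordinate of \<open>h\<close> varies by at most
          \<open>r\<close>, hence \<open>h\<close> by at most \<open>2 * r\<close>. The lower bound
          for integrals doubles this once more, giving \<open>4 * r\<close>.\<close>
        have "set_lebesgue_integral N (A k) (\<lambda>x. norm (h x)) \<le> norm (\<nu> (A k)) + 4 * r * measure N (A k)"
          using norm_set_integral_lower[OF N(1) h, of "A k" "2 * r"] osc A N \<nu> by simp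
        then have "emeasure ?D (A k) \<le> ennreal (norm (\<nu> (A k)) + 4 * r * measure N (A k))"
          using D[OF A] by (simp add: ennreal_leI)
        then show ?thesis
          using r by (simp add: ennreal_plus ennreal_mult emeasure_eq_measure)
      qed
      have "emeasure ?D E = (\<Sum>k. emeasure ?D (A k))"
        by (subst suminf_emeasure) (use Ap N in \<open>auto simp: part_def\<close>)
      also have "\<dots> \<le> (\<Sum>k. ennreal (norm (\<nu> (A k))) + ennreal (4 * r) * emeasure N (A k))"
        by (intro suminf_le cell) auto
      also have "\<dots> = (\<Sum>k. ennreal (norm (\<nu> (A k)))) + ennreal (4 * r) * (\<Sum>k. emeasure N (A k))"
        by (simp add: suminf_add[symmetric])
      also have "(\<Sum>k. emeasure N (A k)) = emeasure N E"
        by (subst suminf_emeasure) (use Ap N in \<open>auto simp: part_def\<close>)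
      also have "(\<Sum>k. ennreal (norm (\<nu> (A k)))) + ennreal (4 * r) * emeasure N E \<le> V E + ennreal e"
      proof (rule add_mono)
        show "(\<Sum>k. ennreal (norm (\<nu> (A k)))) \<le> V E"
          unfolding V_def by (rule SUP_upper[OF Ap])
        have "4 * r * K \<le> e"
          using K e by (simp add: r_def field_simps)
        then have "4 * r * measure N E \<le> e"
          using order_trans[OF mult_left_mono[OF bounded_measure[of E], of "4 * r"]] r
          unfolding K_def by simp
        then show "ennreal (4 * r) * emeasure N E \<le> ennreal e"
          using r by (simp add: emeasure_eq_measure ennreal_mult[symmetric] ennreal_leI)
      qed
      finally show "emeasure ?D E \<le> V E + ennreal e" .
    qed
  qed
  then have "measure_of (space M) (sets M) V = measure_of (space M) (sets M) (emeasure ?D)"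
    by (intro measure_of_eq sets.space_closed) (simp add: sets.sigma_sets_eq)
  also have "\<dots> = ?D"
    using measure_of_of_measure[of ?D] sp N(2) by simp
  finally show ?thesis
    unfolding variation_def V_def part_def .
qed

lemma sets_variation [simp, measurable_cong]: "sets (variation M \<mu>) = sets M"
  and space_variation [simp]: "space (variation M \<mu>) = space M"
  by (simp_all add: variation_def)

lemma finite_measure_variation:
  assumes "complex_measure M \<mu>"
  shows "finite_measure (variation M \<mu>)"
proof -
  obtain N h where N: "finite_measure N" "sets N = sets M" "integrable N h"
    "\<And>E. E \<in> sets M \<Longrightarrow> \<mu> E = set_lebesgue_integral N E h"
    using complex_measure_density[OF assms] by blast
  have "(\<integral>\<^sup>+ x. ennreal (norm (h x)) \<partial>N) < \<infinity>"
    using N(3) by (simp add: integrable_iff_bounded)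
  moreover have "variation M \<mu> = density N (\<lambda>x. ennreal (norm (h x)))"
    by (rule variation_density[OF N])
  ultimately show ?thesis
    using N(3) by (intro finite_measureI) (auto simp: emeasure_density cong: nn_integral_cong)
qed

text \<open>Shows that the choice operator in the definition has a witness: normalise any density
  \<open>h\<close> of \<mu>, which has total variation of density \<open>norm h\<close>.\<close>

lemma polar_density:
  assumes "complex_measure M \<mu>"
  shows polar_density_measurable: "polar_density M \<mu> \<in> borel_measurable M"
    and norm_polar_density: "\<And>x. x \<in> space M \<Longrightarrow> norm (polar_density M \<mu> x) = 1"
    and polar_density_integral:
      "\<And>E. E \<in> sets M \<Longrightarrow> \<mu> E = set_lebesgue_integral (variation M \<mu>) E (polar_density M \<mu>)"
proof -
  obtain N h where N: "finite_measure N" "sets N = sets M" and h[measurable]: "integrable N h"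
    and \<mu>: "\<And>E. E \<in> sets M \<Longrightarrow> \<mu> E = set_lebesgue_integral N E h"
    using complex_measure_density[OF assms] by blast
  have V: "variation M \<mu> = density N (\<lambda>x. ennreal (norm (h x)))"
    by (rule variation_density[OF N h \<mu>])
  \<comment> \<open>The zeros of \<open>h\<close> are null for the total variation, but modulus 1 is
    demanded at every point, so a value of modulus 1 is put there.\<close>
  define p where "p x = (if h x = 0 then 1 else h x / norm (h x))" for x
  have [measurable]: "h \<in> borel_measurable N" using h by auto
  have p[measurable]: "p \<in> borel_measurable N" unfolding p_def by measurable
  have "set_lebesgue_integral (variation M \<mu>) E p = set_lebesgue_integral N E h" if "E \<in> sets M" for E
  proof -
    have "set_lebesgue_integral (variation M \<mu>) E p = (\<integral>x. norm (h x) *\<^sub>R (indicator E x *\<^sub>R p x) \<partial>N)"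
      unfolding set_lebesgue_integral_def V
      using that N by (intro integral_density) auto
    also have "\<dots> = set_lebesgue_integral N E h"
      unfolding set_lebesgue_integral_def
      by (intro Bochner_Integration.integral_cong) (auto simp: p_def scaleR_conv_of_real indicator_def)
    finally show ?thesis .
  qed
  moreover have "p \<in> borel_measurable M"
    using p N(2) by (simp cong: measurable_cong_sets)
  moreover have "norm (p x) = 1" for x by (simp add: p_def norm_divide)
  ultimately have ex: "\<exists>p. p \<in> borel_measurable M \<and> (\<forall>x\<in>space M. norm (p x) = 1) \<and>
     (\<forall>E\<in>sets M. \<mu> E = set_lebesgue_integral (variation M \<mu>) E p)"
    using \<mu> by (intro exI[of _ p]) auto
  note * = someI_ex[OF ex, folded polar_density_def]
  show "polar_density M \<mu> \<in> borel_measurable M" using * by blast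
  show "norm (polar_density M \<mu> x) = 1" if "x \<in> space M" for x using * that by blast
  show "\<mu> E = set_lebesgue_integral (variation M \<mu>) E (polar_density M \<mu>)" if "E \<in> sets M" for E
    using * that by blast
qed

lemma integrable_polar_density:
  assumes "complex_measure M \<mu>"
  shows "integrable (variation M \<mu>) (polar_density M \<mu>)"
proof -
  interpret finite_measure "variation M \<mu>" by (rule finite_measure_variation[OF assms])
  show ?thesis
    by (rule integrable_const_bound[of _ 1])
      (use norm_polar_density[OF assms] polar_density_measurable[OF assms] in auto)
qed

section \<open>Integrals against a complex measure given by a density\<close>

text \<open>Removes the arbitrary choice in \<open>polar_density\<close>: \<open>norm (h x)\<close>
  times the chosen density and \<open>h x\<close> have the same integral over every measurable set,
  so they agree almost everywhere.\<close>

lemma cm_integral_of_density: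
  fixes h :: "'a \<Rightarrow> complex"
  assumes N: "finite_measure N" "sets N = sets M" and h: "integrable N h"
    and \<nu>: "\<And>E. E \<in> sets M \<Longrightarrow> \<nu> E = set_lebesgue_integral N E h"
    and g[measurable]: "g \<in> borel_measurable M"
  shows "cm_integral M \<nu> g = (\<integral>x. g x * h x \<partial>N)"
proof -
  have cm: "complex_measure M \<nu>"
    by (rule complex_measure_of_density[OF h N(2) \<nu>])
  let ?p = "polar_density M \<nu>"
  have V: "variation M \<nu> = density N (\<lambda>x. ennreal (norm (h x)))"
    by (rule variation_density[OF N h \<nu>])
  have h'[measurable]: "h \<in> borel_measurable N" using h by auto
  have p[measurable]: "?p \<in> borel_measurable N"
    using polar_density_measurable[OF cm] N(2) by (simp cong: measurable_cong_sets)
  have g'[measurable]: "g \<in> borel_measurable N"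
    using g N(2) by (simp cong: measurable_cong_sets)
  have "AE x in N. norm (h x) *\<^sub>R ?p x = h x"
  proof (rule AE_eq_of_set_integral)
    show "integrable N (\<lambda>x. norm (h x) *\<^sub>R ?p x)"
      using integrable_polar_density[OF cm] unfolding V by (simp add: integrable_density)
    fix E assume E: "E \<in> sets N"
    have "set_lebesgue_integral N E h = set_lebesgue_integral (variation M \<nu>) E ?p"
      using \<nu> polar_density_integral[OF cm] E N by auto
    also have "\<dots> = (\<integral>x. norm (h x) *\<^sub>R (indicator E x *\<^sub>R ?p x) \<partial>N)"
      unfolding set_lebesgue_integral_def V using E by (intro integral_density) auto
    also have "\<dots> = set_lebesgue_integral N E (\<lambda>x. norm (h x) *\<^sub>R ?p x)"
      unfolding set_lebesgue_integral_def by (simp add: mult_ac)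
    finally show "set_lebesgue_integral N E (\<lambda>x. norm (h x) *\<^sub>R ?p x) = set_lebesgue_integral N E h" by simp
  qed (rule h)
  then have ae: "AE x in N. norm (h x) *\<^sub>R (g x * ?p x) = g x * h x"
    by eventually_elim (metis mult_scaleR_right)
  have "cm_integral M \<nu> g = (\<integral>x. norm (h x) *\<^sub>R (g x * ?p x) \<partial>N)"
    unfolding cm_integral_def V by (intro integral_density) auto
  also have "\<dots> = (\<integral>x. g x * h x \<partial>N)"
    by (intro integral_cong_AE ae) auto
  finally show ?thesis .
qed

text \<open>With respect to the total variation of \<mu>, the measure in question has density
  \<open>f\<close> times the polar density, whose modulus is that of \<open>f\<close>. All three
  claims are then facts about measures with a density.\<close>

lemma cm_density:
  assumes \<mu>: "complex_measure M \<mu>" and f: "integrable (variation M \<mu>) f"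
  shows complex_measure_cm_density: "complex_measure M (cm_density M f \<mu>)"
    and variation_cm_density:
      "variation M (cm_density M f \<mu>) = density (variation M \<mu>) (\<lambda>x. ennreal (norm (f x)))"
    and cm_integral_cm_density: "\<And>g. g \<in> borel_measurable M \<Longrightarrow>
      cm_integral M (cm_density M f \<mu>) g = cm_integral M \<mu> (\<lambda>x. g x * f x)"
proof -
  let ?V = "variation M \<mu>" and ?p = "polar_density M \<mu>"
  have fin: "finite_measure ?V" by (rule finite_measure_variation[OF \<mu>])
  have [measurable]: "?p \<in> borel_measurable M" by (rule polar_density_measurable[OF \<mu>])
  have [measurable]: "f \<in> borel_measurable M"
    using f by (auto dest: borel_measurable_integrable cong: measurable_cong_sets)
  have h: "integrable ?V (\<lambda>x. f x * ?p x)"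
    by (rule Bochner_Integration.integrable_bound[OF f])
      (auto simp: norm_mult norm_polar_density[OF \<mu>])
  have d: "cm_density M f \<mu> E = set_lebesgue_integral ?V E (\<lambda>x. f x * ?p x)" for E
    unfolding cm_density_def cm_integral_def set_lebesgue_integral_def
    by (intro Bochner_Integration.integral_cong) (auto simp: indicator_def)
  show "complex_measure M (cm_density M f \<mu>)"
    by (rule complex_measure_of_density[OF h _ d]) simp
  have "variation M (cm_density M f \<mu>) = density ?V (\<lambda>x. ennreal (norm (f x * ?p x)))"
    by (rule variation_density[OF fin _ h d]) simp
  also have "\<dots> = density ?V (\<lambda>x. ennreal (norm (f x)))"
    by (rule density_cong) (auto simp: norm_mult norm_polar_density[OF \<mu>])
  finally show "variation M (cm_density M f \<mu>) = density ?V (\<lambda>x. ennreal (norm (f x)))" .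
  show "cm_integral M (cm_density M f \<mu>) g = cm_integral M \<mu> (\<lambda>x. g x * f x)"
    if "g \<in> borel_measurable M" for g
    using cm_integral_of_density[OF fin _ h d that]
    by (simp add: cm_integral_def mult.assoc)
qed

subsection \<open>Integration against kernels of positive measures\<close>

text \<open>Over a completion every subset of a null set is measurable, so \<open>g\<close> inherits
  measurability with nothing known about it on the exceptional set. This is how families specified
  only almost everywhere are handled.\<close>

lemma borel_measurable_completion_AE:
  fixes f g :: "'a \<Rightarrow> 'b::topological_space"
  assumes f: "f \<in> borel_measurable (completion M)" and eq: "AE x in M. f x = g x"
  shows "g \<in> borel_measurable (completion M)"
proof (rule measurableI)
  fix S :: "'b set" assume S: "S \<in> sets borel"
  show "g -` S \<inter> space (completion M) \<in> sets (completion M)"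
  proof (rule completion.in_sets_AE)
    show "AE x in completion M. x \<in> f -` S \<inter> space (completion M) \<longleftrightarrow> x \<in> g -` S \<inter> space (completion M)"
      using AE_completion[OF eq] by eventually_elim auto
    show "f -` S \<inter> space (completion M) \<in> sets (completion M)"
      using f S by (rule measurable_sets)
  qed auto
qed simp

lemma integral_completion_cong_AE:
  fixes f g :: "'a \<Rightarrow> 'b::{banach, second_countable_topology}"
  assumes f: "integrable (completion M) f" and eq: "AE x in M. f x = g x"
  shows "integrable (completion M) g" "integral\<^sup>L (completion M) g = integral\<^sup>L (completion M) f"
proof -
  have [measurable]: "f \<in> borel_measurable (completion M)"
    using f by auto
  have g[measurable]: "g \<in> borel_measurable (completion M)"
    by (rule borel_measurable_completion_AE[OF _ eq]) measurable
  have ae: "AE x in completion M. g x = f x"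
    using AE_completion[OF eq] by eventually_elim simp
  show "integrable (completion M) g"
    using f by (subst integrable_cong_AE[OF _ _ ae]) auto
  show "integral\<^sup>L (completion M) g = integral\<^sup>L (completion M) f"
    by (rule integral_cong_AE[OF _ _ ae]) auto
qed

text \<open>States that \<open>L\<close> is the mixture of the positive measures \<open>K z\<close>
  over \<open>N\<close>. Later \<open>L\<close> is the total variation of \<mu>, and
  \<open>K z\<close> agrees almost everywhere with the total variation of the fibre measure.\<close>

locale disintegration =
  fixes M L :: "'a measure" and N :: "'z measure" and K :: "'z \<Rightarrow> 'a measure"
  assumes L: "sets L = sets M" and K: "\<And>z. sets (K z) = sets M"
    and meas: "\<And>A. A \<in> sets M \<Longrightarrow> (\<lambda>z. emeasure (K z) A) \<in> borel_measurable N"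
    and em: "\<And>A. A \<in> sets M \<Longrightarrow> emeasure L A = (\<integral>\<^sup>+ z. emeasure (K z) A \<partial>N)"
begin

text \<open>The standard induction over nonnegative measurable functions. Measurability and the
  integral formula go through it together because the additive and monotone steps of the formula
  need the inner integrals to be measurable.\<close>

lemma kernel_nn_integral:
  fixes f :: "'a \<Rightarrow> ennreal"
  assumes f: "f \<in> borel_measurable M"
  shows "(\<lambda>z. \<integral>\<^sup>+ x. f x \<partial>K z) \<in> borel_measurable N \<and>
    (\<integral>\<^sup>+ x. f x \<partial>L) = (\<integral>\<^sup>+ z. \<integral>\<^sup>+ x. f x \<partial>K z \<partial>N)"
proof -
  have sp: "space (K z) = space M" "space L = space M" for z
    using K L sets_eq_imp_space_eq by blast+
  have KM: "g \<in> borel_measurable (K z)" "g \<in> borel_measurable L" if "g \<in> borel_measurable M"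
    for g :: "'a \<Rightarrow> ennreal" and z
    using that K L by (simp_all cong: measurable_cong_sets)
  show ?thesis
    using f
  proof (induction rule: borel_measurable_induct)
    case (cong f g)
    have "(\<integral>\<^sup>+ x. f x \<partial>K z) = (\<integral>\<^sup>+ x. g x \<partial>K z)" "(\<integral>\<^sup>+ x. f x \<partial>L) = (\<integral>\<^sup>+ x. g x \<partial>L)" for z
      by (intro nn_integral_cong; simp add: cong sp)+
    then show ?case using cong by simp
  next
    case (set A)
    then show ?case using meas em K L by simp
  next
    case (mult u c)
    then show ?case by (auto simp: KM nn_integral_cmult)
  next
    case (add u v)
    then show ?case by (auto simp: KM nn_integral_add)
  next
    case (seq U)
    have inc: "incseq (\<lambda>i. \<integral>\<^sup>+ x. U i x \<partial>K z)" for z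
      using \<open>incseq U\<close> by (auto simp: incseq_def le_fun_def intro!: nn_integral_mono)
    have "(\<integral>\<^sup>+ x. (SUP i. U i x) \<partial>K z) = (SUP i. \<integral>\<^sup>+ x. U i x \<partial>K z)" for z
      by (rule nn_integral_monotone_convergence_SUP) (use seq.hyps in \<open>simp_all add: KM\<close>)
    moreover have "(\<integral>\<^sup>+ x. (SUP i. U i x) \<partial>L) = (SUP i. \<integral>\<^sup>+ x. U i x \<partial>L)"
      by (rule nn_integral_monotone_convergence_SUP) (use seq.hyps in \<open>simp_all add: KM\<close>)
    moreover have "(\<integral>\<^sup>+ z. (SUP i. \<integral>\<^sup>+ x. U i x \<partial>K z) \<partial>N) = (SUP i. \<integral>\<^sup>+ z. \<integral>\<^sup>+ x. U i x \<partial>K z \<partial>N)"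
      by (rule nn_integral_monotone_convergence_SUP)
        (use seq.IH inc in \<open>auto simp: incseq_def le_fun_def\<close>)
    moreover have "(\<lambda>z. SUP i. \<integral>\<^sup>+ x. U i x \<partial>K z) \<in> borel_measurable N"
      by (rule borel_measurable_SUP) (use seq.IH in auto)
    ultimately show ?case
      using seq.IH by (simp add: image_image SUP_apply)
  qed
qed

lemma kernel_integral_real:
  fixes f :: "'a \<Rightarrow> real"
  assumes f: "integrable L f"
  shows "AE z in N. integrable (K z) f" "integrable N (\<lambda>z. \<integral>x. f x \<partial>K z)"
    "(\<integral>x. f x \<partial>L) = (\<integral>z. \<integral>x. f x \<partial>K z \<partial>N)"
proof -
  note kernel = kernel_nn_integral
  have fM[measurable]: "f \<in> borel_measurable M"
    using f L by (auto dest: borel_measurable_integrable cong: measurable_cong_sets)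
  have fK[measurable]: "f \<in> borel_measurable (K z)" for z
    using fM K by (simp cong: measurable_cong_sets)
  have 1: "(\<lambda>z. \<integral>\<^sup>+ x. ennreal (norm (f x)) \<partial>K z) \<in> borel_measurable N"
    and m1: "(\<integral>\<^sup>+ x. ennreal (norm (f x)) \<partial>L) = (\<integral>\<^sup>+ z. \<integral>\<^sup>+ x. ennreal (norm (f x)) \<partial>K z \<partial>N)"
    using kernel[of "\<lambda>x. ennreal (norm (f x))"] by auto
  \<comment> \<open>\<open>ennreal\<close> sends negative reals to 0, so this concerns the positive
    part of \<open>f\<close> and the next fact the negative part.\<close>
  have 2: "(\<lambda>z. \<integral>\<^sup>+ x. ennreal (f x) \<partial>K z) \<in> borel_measurable N"
    and m2: "(\<integral>\<^sup>+ x. ennreal (f x) \<partial>L) = (\<integral>\<^sup>+ z. \<integral>\<^sup>+ x. ennreal (f x) \<partial>K z \<partial>N)"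
    using kernel[of "\<lambda>x. ennreal (f x)"] by auto
  have 3: "(\<lambda>z. \<integral>\<^sup>+ x. ennreal (- f x) \<partial>K z) \<in> borel_measurable N"
    and m3: "(\<integral>\<^sup>+ x. ennreal (- f x) \<partial>L) = (\<integral>\<^sup>+ z. \<integral>\<^sup>+ x. ennreal (- f x) \<partial>K z \<partial>N)"
    using kernel[of "\<lambda>x. ennreal (- f x)"] by auto
  have fin: "(\<integral>\<^sup>+ z. \<integral>\<^sup>+ x. ennreal (norm (f x)) \<partial>K z \<partial>N) < \<infinity>"
    using f m1 by (simp add: integrable_iff_bounded)
  have le: "(\<integral>\<^sup>+ x. ennreal (f x) \<partial>K z) \<le> (\<integral>\<^sup>+ x. ennreal (norm (f x)) \<partial>K z)"
    "(\<integral>\<^sup>+ x. ennreal (- f x) \<partial>K z) \<le> (\<integral>\<^sup>+ x. ennreal (norm (f x)) \<partial>K z)" for z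
    by (intro nn_integral_mono ennreal_leI; simp)+
  have "AE z in N. (\<integral>\<^sup>+ x. ennreal (norm (f x)) \<partial>K z) \<noteq> \<infinity>"
    by (rule nn_integral_PInf_AE[OF 1]) (use fin in auto)
  then show ae: "AE z in N. integrable (K z) f"
    by eventually_elim (simp add: integrable_iff_bounded less_top)
  \<comment> \<open>Here \<open>u\<close> is dominated by a function of finite integral, so it is
    finite almost everywhere and \<open>enn2real\<close> loses nothing.\<close>
  have part: "integrable N (\<lambda>z. enn2real (u z))" "(\<integral>z. enn2real (u z) \<partial>N) = enn2real (\<integral>\<^sup>+ z. u z \<partial>N)"
    if u[measurable]: "u \<in> borel_measurable N"
      and le: "\<And>z. u z \<le> (\<integral>\<^sup>+ x. ennreal (norm (f x)) \<partial>K z)" for u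
  proof -
    have "(\<integral>\<^sup>+ z. u z \<partial>N) \<le> (\<integral>\<^sup>+ z. \<integral>\<^sup>+ x. ennreal (norm (f x)) \<partial>K z \<partial>N)"
      by (intro nn_integral_mono le)
    then have ufin: "(\<integral>\<^sup>+ z. u z \<partial>N) < \<infinity>"
      using fin by (rule le_less_trans)
    then have "AE z in N. u z \<noteq> \<infinity>"
      by (intro nn_integral_PInf_AE) auto
    then have "AE z in N. ennreal (enn2real (u z)) = u z"
      by eventually_elim (simp add: less_top)
    then have eq: "(\<integral>\<^sup>+ z. ennreal (enn2real (u z)) \<partial>N) = (\<integral>\<^sup>+ z. u z \<partial>N)"
      by (rule nn_integral_cong_AE)
    show "integrable N (\<lambda>z. enn2real (u z))"
      by (rule integrableI_nonneg) (use eq ufin in auto)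
    show "(\<integral>z. enn2real (u z) \<partial>N) = enn2real (\<integral>\<^sup>+ z. u z \<partial>N)"
      by (subst integral_eq_nn_integral) (use eq in auto)
  qed
  let ?d = "\<lambda>z. enn2real (\<integral>\<^sup>+ x. ennreal (f x) \<partial>K z) - enn2real (\<integral>\<^sup>+ x. ennreal (- f x) \<partial>K z)"
  have d: "integrable N ?d"
    by (intro Bochner_Integration.integrable_diff part(1) 2 3 le)
  have aed: "AE z in N. ?d z = (\<integral>x. f x \<partial>K z)"
    using ae by eventually_elim (simp add: real_lebesgue_integral_def)
  have mea: "(\<lambda>z. \<integral>x. f x \<partial>K z) \<in> borel_measurable N"
  proof -
    \<comment> \<open>An identity at every \<open>z\<close>, since an almost-everywhere one would
      not give measurability for a general \<open>N\<close>. Where \<open>f\<close> is not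
      integrable over \<open>K z\<close>, the Bochner integral has its default value 0.\<close>
    have e: "(\<integral>x. f x \<partial>K z) = (if (\<integral>\<^sup>+ x. ennreal (norm (f x)) \<partial>K z) < \<infinity> then ?d z else 0)" for z
    proof (cases "integrable (K z) f")
      case True
      then show ?thesis
        by (simp add: real_lebesgue_integral_def integrable_iff_bounded)
    next
      case False
      then show ?thesis
        by (simp add: not_integrable_integral_eq integrable_iff_bounded)
    qed
    show ?thesis unfolding e using 1 2 3 by measurable
  qed
  show "integrable N (\<lambda>z. \<integral>x. f x \<partial>K z)"
    using d aed mea by (subst integrable_cong_AE[where g="?d"]) auto
  have "(\<integral>z. \<integral>x. f x \<partial>K z \<partial>N) = (\<integral>z. ?d z \<partial>N)"
    using d aed mea by (intro integral_cong_AE) auto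
  also have "\<dots> = enn2real (\<integral>\<^sup>+ x. ennreal (f x) \<partial>L) - enn2real (\<integral>\<^sup>+ x. ennreal (- f x) \<partial>L)"
    using part[OF 2 le(1)] part[OF 3 le(2)] by (simp add: m2 m3)
  also have "\<dots> = (\<integral>x. f x \<partial>L)"
    using f by (simp add: real_lebesgue_integral_def)
  finally show "(\<integral>x. f x \<partial>L) = (\<integral>z. \<integral>x. f x \<partial>K z \<partial>N)" by simp
qed

lemma kernel_integral_complex:
  fixes f :: "'a \<Rightarrow> complex"
  assumes f: "integrable L f"
  shows "AE z in N. integrable (K z) f" "integrable N (\<lambda>z. \<integral>x. f x \<partial>K z)"
    "(\<integral>x. f x \<partial>L) = (\<integral>z. \<integral>x. f x \<partial>K z \<partial>N)"
proof -
  note kernel = kernel_integral_real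
  have fM: "f \<in> borel_measurable M"
    using f L by (auto dest: borel_measurable_integrable cong: measurable_cong_sets)
  have fK: "f \<in> borel_measurable (K z)" for z
    using fM K by (simp cong: measurable_cong_sets)
  have "integrable L (\<lambda>x. norm (f x))" using f by simp
  then have "AE z in N. integrable (K z) (\<lambda>x. norm (f x))"
    by (rule kernel(1))
  then have ae: "AE z in N. integrable (K z) f"
    by eventually_elim (simp add: integrable_norm_iff[OF fK])
  then show "AE z in N. integrable (K z) f" .
  have split: "(\<integral>x. f x \<partial>Q) = of_real (\<integral>x. Re (f x) \<partial>Q) + \<i> * of_real (\<integral>x. Im (f x) \<partial>Q)"
    if "integrable Q f" for Q
    using that by (simp add: complex_eq_iff)
  let ?d = "\<lambda>z. of_real (\<integral>x. Re (f x) \<partial>K z) + \<i> * of_real (\<integral>x. Im (f x) \<partial>K z)"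
  have ReL: "integrable L (\<lambda>x. Re (f x))" and ImL: "integrable L (\<lambda>x. Im (f x))"
    using f by auto
  note ReK = kernel(2)[OF ReL] and ImK = kernel(2)[OF ImL]
  have d: "integrable N ?d"
    using ReK ImK by (intro Bochner_Integration.integrable_add integrable_mult_right integrable_of_real)
  have aed: "AE z in N. ?d z = (\<integral>x. f x \<partial>K z)"
    using ae by eventually_elim (simp add: complex_eq_iff)
  have mea: "(\<lambda>z. \<integral>x. f x \<partial>K z) \<in> borel_measurable N"
  proof -
    have e: "(\<integral>x. f x \<partial>K z) = (if (\<integral>\<^sup>+ x. ennreal (norm (f x)) \<partial>K z) < \<infinity> then ?d z else 0)" for z
    proof (cases "integrable (K z) f")
      case True
      then have "(\<integral>\<^sup>+ x. ennreal (norm (f x)) \<partial>K z) < \<infinity>"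
        by (simp add: integrable_iff_bounded)
      then show ?thesis unfolding split[OF True] by simp
    next
      case False
      then show ?thesis
        using fK by (simp add: not_integrable_integral_eq integrable_iff_bounded)
    qed
    have [measurable]: "(\<lambda>z. \<integral>\<^sup>+ x. ennreal (norm (f x)) \<partial>K z) \<in> borel_measurable N"
      using kernel_nn_integral[of "\<lambda>x. ennreal (norm (f x))"] fM by auto
    have [measurable]: "?d \<in> borel_measurable N" using d by auto
    show ?thesis unfolding e by measurable
  qed
  show "integrable N (\<lambda>z. \<integral>x. f x \<partial>K z)"
    using d aed mea by (subst integrable_cong_AE[where g="?d"]) auto
  have "(\<integral>z. \<integral>x. f x \<partial>K z \<partial>N) = (\<integral>z. ?d z \<partial>N)"
    using d aed mea by (intro integral_cong_AE) auto
  also have "\<dots> = of_real (\<integral>z. \<integral>x. Re (f x) \<partial>K z \<partial>N) + \<i> * of_real (\<integral>z. \<integral>x. Im (f x) \<partial>K z \<partial>N)"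
    using integrable_of_real[OF ReK, where 'a=complex] integrable_of_real[OF ImK, where 'a=complex]
    by simp
  also have "\<dots> = (\<integral>x. f x \<partial>L)"
    unfolding split[OF f] kernel(3)[OF ReL] kernel(3)[OF ImL] by (rule refl)
  finally show "(\<integral>x. f x \<partial>L) = (\<integral>z. \<integral>x. f x \<partial>K z \<partial>N)" by simp
qed

end

subsection \<open>Integration against kernels of complex measures\<close>

text \<open>An open set is an increasing union of finite unions of basis sets, so the sign condition
  passes to open sets. A Borel set is approximated from outside by open ones, and as
  \<open>norm q\<close> is at most 1 the integral moves by no more than the excess measure. The
  point of the hypothesis is that it consists of countably many conditions.\<close>

lemma AE_nonneg_of_basis:
  fixes L :: "'a::polish_space measure" and q :: "'a \<Rightarrow> complex"
  assumes L: "finite_measure L" "sets L = sets borel" and q: "integrable L q"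
    and bound: "\<And>x. norm (q x) \<le> 1"
    and B: "countable B" "topological_basis B"
    and pos: "\<And>F. finite F \<Longrightarrow> F \<subseteq> B \<Longrightarrow>
      0 \<le> Re (set_lebesgue_integral L (\<Union>F) q) \<and> Im (set_lebesgue_integral L (\<Union>F) q) = 0"
  shows "AE x in L. 0 \<le> Re (q x) \<and> Im (q x) = 0"
proof (rule AE_nonneg_complex_of_set_integral[OF q])
  interpret finite_measure L by fact
  let ?I = "\<lambda>E. set_lebesgue_integral L E q"
  have si: "set_integrable L E q" if "E \<in> sets L" for E
    unfolding set_integrable_def by (rule integrable_mult_indicator[OF that q])
  have pos_open: "0 \<le> Re (?I U) \<and> Im (?I U) = 0" if U: "open U" for U
  proof -
    have "\<exists>B'. B' \<subseteq> B \<and> \<Union>B' = U"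
      using B(2) U by (simp add: topological_basis_def)
    then obtain B' where B': "B' \<subseteq> B" "\<Union>B' = U"
      by (elim exE conjE)
    show ?thesis
    proof (cases "B' = {}")
      case True
      then have "U = {}" using B'(2) by simp
      then show ?thesis by (simp add: set_lebesgue_integral_def)
    next
      case False
      \<comment> \<open>An enumeration by all natural numbers, possibly with repetitions; it exists
        only for nonempty \<open>B'\<close>, hence the case split.\<close>
      define g where "g = from_nat_into B'"
      have rg: "range g = B'"
        unfolding g_def by (rule range_from_nat_into[OF False countable_subset[OF B'(1) B(1)]])
      have gB: "g i \<in> B" for i using rg B' by auto
      then have gs: "g i \<in> sets L" for i
        using B(2) L(2) topological_basis_open by fastforce
      define W where "W n = (\<Union>i<n. g i)" for n
      have Wm: "W n \<in> sets L" for n using gs by (simp add: W_def)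
      have "(\<lambda>n. ?I (W n)) \<longlonglongrightarrow> ?I (\<Union>n. W n)"
      proof (rule set_integral_cont_up)
        show "W n \<in> sets L" for n by (rule Wm)
        show "incseq W" unfolding W_def incseq_def by force
        show "set_integrable L (\<Union>n. W n) q" using Wm by (intro si sets.countable_UN) auto
      qed
      moreover have "(\<Union>n. W n) = U"
        unfolding W_def using rg B'(2) by blast
      ultimately have lim: "(\<lambda>n. ?I (W n)) \<longlonglongrightarrow> ?I U" by simp
      have W: "0 \<le> Re (?I (W n)) \<and> Im (?I (W n)) = 0" for n
        unfolding W_def by (rule pos) (use gB in auto)
      have "(\<lambda>n. Im (?I (W n))) \<longlonglongrightarrow> Im (?I U)" "(\<lambda>n. Re (?I (W n))) \<longlonglongrightarrow> Re (?I U)"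
        using lim by (auto intro: tendsto_Im tendsto_Re)
      then show ?thesis
        using W LIMSEQ_le_const[of "\<lambda>n. Re (?I (W n))" "Re (?I U)" 0] by (simp add: LIMSEQ_const_iff)
    qed
  qed
  have "norm (?I U - ?I E) \<le> measure L U - measure L E"
    if E: "E \<in> sets L" and U: "open U" "E \<subseteq> U" for E U
  proof -
    have U': "U \<in> sets L" using U L by simp
    have D: "U - E \<in> sets L" using E U' by auto
    have "?I (E \<union> (U - E)) = ?I E + ?I (U - E)"
      by (rule set_integral_Un) (use E D in \<open>auto intro: si\<close>)
    moreover have "E \<union> (U - E) = U" using U by auto
    moreover have "norm (?I (U - E)) \<le> set_lebesgue_integral L (U - E) (\<lambda>x. norm (q x))"
      by (rule set_integral_norm_bound[OF si[OF D]])
    moreover have "set_lebesgue_integral L (U - E) (\<lambda>x. norm (q x)) \<le> set_lebesgue_integral L (U - E) (\<lambda>x. 1)"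
    proof (rule set_integral_mono)
      show "set_integrable L (U - E) (\<lambda>x. norm (q x))"
        by (rule set_integrable_norm[OF si[OF D]])
      show "set_integrable L (U - E) (\<lambda>x. 1::real)"
        unfolding set_integrable_def by (rule integrable_mult_indicator[OF D]) simp
    qed (rule bound)
    moreover have "set_lebesgue_integral L (U - E) (\<lambda>x. 1::real) = measure L U - measure L E"
      using D finite_measure_Diff[OF U' E U(2)] by (simp add: set_lebesgue_integral_def)
    ultimately show ?thesis by simp
  qed
  note close = this
  fix E assume E: "E \<in> sets L"
  \<comment> \<open>Both conditions are exact on open sets, and an open superset of excess measure
    below \<open>e\<close> transfers them to \<open>E\<close> up to \<open>e\<close>.\<close>
  have approx: "0 - e \<le> Re (?I E) \<and> \<bar>Im (?I E)\<bar> \<le> e" if e: "0 < e" for e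
  proof -
    have "emeasure L E < emeasure L E + ennreal e"
      using e by (simp add: ennreal_add_left_cancel_less)
    moreover have "emeasure L E = (INF U\<in>{U. E \<subseteq> U \<and> open U}. emeasure L U)"
    proof (rule outer_regular[OF L(2)])
      show "emeasure L (space L) \<noteq> \<infinity>" by simp
      show "E \<in> sets borel" using E L(2) by simp
    qed
    ultimately have "(INF U\<in>{U. E \<subseteq> U \<and> open U}. emeasure L U) < emeasure L E + ennreal e"
      by (simp only:)
    then have "\<exists>U\<in>{U. E \<subseteq> U \<and> open U}. emeasure L U < emeasure L E + ennreal e"
      by (simp only: INF_less_iff)
    then obtain U where U: "open U" "E \<subseteq> U" "emeasure L U < emeasure L E + ennreal e"
      by auto
    have "ennreal (measure L U) < ennreal (measure L E + e)"
      using U(3) e by (simp add: emeasure_eq_measure ennreal_plus)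
    then have "measure L U < measure L E + e"
      by (simp add: ennreal_less_iff del: ennreal_plus)
    then have "norm (?I U - ?I E) \<le> e"
      using close[OF E U(1,2)] by linarith
    then have "\<bar>Re (?I U - ?I E)\<bar> \<le> e" "\<bar>Im (?I U - ?I E)\<bar> \<le> e"
      using abs_Re_le_cmod abs_Im_le_cmod order_trans by blast+
    then show ?thesis using pos_open[OF U(1)] by auto
  qed
  have "0 \<le> Re (?I E)"
  proof (rule field_le_epsilon)
    show "0 \<le> Re (?I E) + e" if "0 < e" for e using approx[OF that] by linarith
  qed
  moreover have "\<bar>Im (?I E)\<bar> \<le> 0"
  proof (rule field_le_epsilon)
    show "\<bar>Im (?I E)\<bar> \<le> 0 + e" if "0 < e" for e using approx[OF that] by linarith
  qed
  ultimately show "0 \<le> Re (?I E) \<and> Im (?I E) = 0" by simp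
qed

section \<open>Bounded functions and their bounded pointwise limits\<close>

lemma integrable_bounded_polar:
  assumes \<nu>: "complex_measure M \<nu>" and g: "g \<in> borel_measurable M"
    and C: "\<And>x. x \<in> space M \<Longrightarrow> norm (g x) \<le> C"
  shows "integrable (variation M \<nu>) (\<lambda>x. g x * polar_density M \<nu> x)"
proof -
  interpret finite_measure "variation M \<nu>" by (rule finite_measure_variation[OF \<nu>])
  have [measurable]: "polar_density M \<nu> \<in> borel_measurable M" by (rule polar_density_measurable[OF \<nu>])
  show ?thesis
    by (rule integrable_const_bound[of _ C])
      (use C g in \<open>auto simp: norm_mult norm_polar_density[OF \<nu>]\<close>)
qed

text \<open>Supplies a majorant in the kernel parameter for dominated convergence: a constant times
  the variation norm of the fibre measure.\<close>

lemma norm_cm_integral_le: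
  assumes \<nu>: "complex_measure M \<nu>" and g: "g \<in> borel_measurable M"
    and C: "\<And>x. x \<in> space M \<Longrightarrow> norm (g x) \<le> C"
  shows "norm (cm_integral M \<nu> g) \<le> C * variation_norm M \<nu>"
proof -
  interpret finite_measure "variation M \<nu>" by (rule finite_measure_variation[OF \<nu>])
  note i = integrable_bounded_polar[OF assms(1,2), of C]
  have "norm (cm_integral M \<nu> g) \<le> (\<integral>x. norm (g x * polar_density M \<nu> x) \<partial>variation M \<nu>)"
    unfolding cm_integral_def by (rule integral_norm_bound)
  also have "\<dots> \<le> (\<integral>x. C \<partial>variation M \<nu>)"
    using C by (intro integral_mono integrable_norm i) (auto simp: norm_mult norm_polar_density[OF \<nu>])
  finally show ?thesis by (simp add: variation_norm_def mult.commute)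
qed

lemma cm_integral_add:
  assumes \<nu>: "complex_measure M \<nu>"
    and "g \<in> borel_measurable M" "\<And>x. x \<in> space M \<Longrightarrow> norm (g x) \<le> C"
    and "h \<in> borel_measurable M" "\<And>x. x \<in> space M \<Longrightarrow> norm (h x) \<le> D"
  shows "cm_integral M \<nu> (\<lambda>x. g x + h x) = cm_integral M \<nu> g + cm_integral M \<nu> h"
  using integrable_bounded_polar[OF \<nu> assms(2), of C] integrable_bounded_polar[OF \<nu> assms(4), of D] assms(3,5)
  by (simp add: cm_integral_def distrib_right)

lemma cm_integral_cmult: "cm_integral M \<nu> (\<lambda>x. c * g x) = c * cm_integral M \<nu> g"
  by (simp add: cm_integral_def mult.assoc)

lemma cm_integral_tendsto:
  assumes \<nu>: "complex_measure M \<nu>" and g: "\<And>n. g n \<in> borel_measurable M" "G \<in> borel_measurable M"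
    and C: "\<And>n x. x \<in> space M \<Longrightarrow> norm (g n x) \<le> C"
    and lim: "\<And>x. x \<in> space M \<Longrightarrow> (\<lambda>n. g n x) \<longlonglongrightarrow> G x"
  shows "(\<lambda>n. cm_integral M \<nu> (g n)) \<longlonglongrightarrow> cm_integral M \<nu> G"
proof -
  interpret finite_measure "variation M \<nu>" by (rule finite_measure_variation[OF \<nu>])
  have [measurable]: "polar_density M \<nu> \<in> borel_measurable M" by (rule polar_density_measurable[OF \<nu>])
  note g[measurable]
  show ?thesis
    unfolding cm_integral_def
  proof (rule integral_dominated_convergence[where w="\<lambda>_. C"])
    show "AE x in variation M \<nu>. (\<lambda>n. g n x * polar_density M \<nu> x) \<longlonglongrightarrow> G x * polar_density M \<nu> x"
      using lim by (intro AE_I2 tendsto_mult tendsto_const) simp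
    show "AE x in variation M \<nu>. norm (g n x * polar_density M \<nu> x) \<le> C" for n
      using C by (intro AE_I2) (simp add: norm_mult norm_polar_density[OF \<nu>])
  qed auto
qed

text \<open>Every \<open>m z\<close> is a complex measure here. Families that are good only almost
  everywhere are made to fit by putting the zero measure at the exceptional points.\<close>

locale complex_kernel =
  fixes M :: "'a measure" and N :: "'z measure" and \<mu> :: "'a set \<Rightarrow> complex"
    and m :: "'z \<Rightarrow> 'a set \<Rightarrow> complex"
  assumes \<mu>: "complex_measure M \<mu>" and m: "\<And>z. complex_measure M (m z)"
    and int: "integrable N (\<lambda>z. variation_norm M (m z))"
begin

text \<open>Boundedness belongs to the predicate because it makes \<open>g\<close> integrable
  against \<mu> and every \<open>m z\<close>, so that the integrals are additive.\<close>

definition decomposes :: "('a \<Rightarrow> complex) \<Rightarrow> bool" where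
  "decomposes g \<longleftrightarrow> g \<in> borel_measurable M \<and> (\<exists>C. \<forall>x\<in>space M. norm (g x) \<le> C) \<and>
     integrable N (\<lambda>z. cm_integral M (m z) g) \<and>
     cm_integral M \<mu> g = (\<integral>z. cm_integral M (m z) g \<partial>N)"

lemma decomposes_add:
  assumes "decomposes g" "decomposes h"
  shows "decomposes (\<lambda>x. g x + h x)"
proof -
  obtain C D where C: "\<And>x. x \<in> space M \<Longrightarrow> norm (g x) \<le> C" and D: "\<And>x. x \<in> space M \<Longrightarrow> norm (h x) \<le> D"
    using assms by (auto simp: decomposes_def)
  have meas: "g \<in> borel_measurable M" "h \<in> borel_measurable M"
    using assms by (auto simp: decomposes_def)
  have add: "cm_integral M \<nu> (\<lambda>x. g x + h x) = cm_integral M \<nu> g + cm_integral M \<nu> h"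
    if "complex_measure M \<nu>" for \<nu>
    by (rule cm_integral_add[OF that meas(1) _ meas(2)]) (use C D in auto)
  have "norm (g x + h x) \<le> C + D" if "x \<in> space M" for x
    using C[OF that] D[OF that] norm_triangle_ineq[of "g x" "h x"] by linarith
  then show ?thesis
    using assms meas unfolding decomposes_def add[OF \<mu>] add[OF m] by auto
qed

lemma decomposes_cmult:
  assumes "decomposes g"
  shows "decomposes (\<lambda>x. c * g x)"
proof -
  obtain C where C: "\<And>x. x \<in> space M \<Longrightarrow> norm (g x) \<le> C"
    using assms by (auto simp: decomposes_def)
  then have "norm (c * g x) \<le> norm c * C" if "x \<in> space M" for x
    using that by (simp add: norm_mult mult_left_mono)
  then show ?thesis
    using assms unfolding decomposes_def cm_integral_cmult by auto
qed

lemma decomposes_sum: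
  assumes "finite I" "I \<noteq> {}" "\<And>i. i \<in> I \<Longrightarrow> decomposes (g i)"
  shows "decomposes (\<lambda>x. \<Sum>i\<in>I. g i x)"
  using assms by (induction I rule: finite_ne_induct) (auto intro: decomposes_add)

text \<open>Dominated convergence twice: on each fibre with the constant majorant \<open>C\<close>,
  then over the parameter with \<open>C\<close> times the variation norm, which is where the
  integrability of these norms enters.\<close>

lemma decomposes_lim:
  assumes g: "\<And>n. decomposes (g n)"
    and C: "\<And>n x. x \<in> space M \<Longrightarrow> norm (g n x) \<le> C"
    and lim: "\<And>x. x \<in> space M \<Longrightarrow> (\<lambda>n. g n x) \<longlonglongrightarrow> G x"
  shows "decomposes G"
proof -
  have gm: "g n \<in> borel_measurable M" for n using g by (auto simp: decomposes_def)
  have Gm: "G \<in> borel_measurable M"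
    by (rule borel_measurable_LIMSEQ_metric[OF gm lim])
  have GC: "norm (G x) \<le> C" if "x \<in> space M" for x
    by (rule LIMSEQ_le_const2[OF tendsto_norm[OF lim[OF that]]]) (use C that in auto)
  have tm: "(\<lambda>n. cm_integral M (m z) (g n)) \<longlonglongrightarrow> cm_integral M (m z) G" for z
    by (rule cm_integral_tendsto[OF m gm Gm C lim])
  have t\<mu>: "(\<lambda>n. cm_integral M \<mu> (g n)) \<longlonglongrightarrow> cm_integral M \<mu> G"
    by (rule cm_integral_tendsto[OF \<mu> gm Gm C lim])
  have gN: "(\<lambda>z. cm_integral M (m z) (g n)) \<in> borel_measurable N" for n
    using g[of n] borel_measurable_integrable by (auto simp: decomposes_def)
  have GN: "(\<lambda>z. cm_integral M (m z) G) \<in> borel_measurable N"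
    by (rule borel_measurable_LIMSEQ_metric[OF gN tm])
  have w: "integrable N (\<lambda>z. C * variation_norm M (m z))"
    using int by simp
  have dom: "norm (cm_integral M (m z) (g n)) \<le> C * variation_norm M (m z)" for n z
    by (rule norm_cm_integral_le[OF m gm C])
  have I: "integrable N (\<lambda>z. cm_integral M (m z) G)"
    by (rule integrable_dominated_convergence[where s="\<lambda>n z. cm_integral M (m z) (g n)", OF GN gN w])
      (use tm dom in auto)
  have "(\<lambda>n. \<integral>z. cm_integral M (m z) (g n) \<partial>N) \<longlonglongrightarrow> (\<integral>z. cm_integral M (m z) G \<partial>N)"
    by (rule integral_dominated_convergence[where s="\<lambda>n z. cm_integral M (m z) (g n)", OF GN gN w])
      (use tm dom in auto)
  moreover have "(\<integral>z. cm_integral M (m z) (g n) \<partial>N) = cm_integral M \<mu> (g n)" for n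
    using g by (auto simp: decomposes_def)
  ultimately have "cm_integral M \<mu> G = (\<integral>z. cm_integral M (m z) G \<partial>N)"
    using t\<mu> LIMSEQ_unique by simp
  then show ?thesis
    unfolding decomposes_def using Gm GC I by blast
qed

end

subsection \<open>Kernels on the sphere\<close>

lemma space_sphere_borel [simp]: "space sphere_borel = csphere"
  by (simp only: sphere_borel_def space_restrict_space space_borel Int_UNIV_right)

lemma sets_sphere_borel_Int: "A \<in> sets borel \<Longrightarrow> A \<inter> csphere \<in> sets sphere_borel"
  unfolding sphere_borel_def sets_restrict_space by (rule image_eqI[of _ _ A]) (simp_all add: Int_commute)

lemma borel_measurable_sphere_borel:
  "f \<in> borel_measurable borel \<Longrightarrow> f \<in> borel_measurable sphere_borel"
  unfolding sphere_borel_def by (rule measurable_restrict_space1)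

lemma borel_measurable_sphere_borel_iff:
  fixes f :: "complex ^ 'd::finite \<Rightarrow> 'b::real_normed_vector"
  shows "f \<in> borel_measurable sphere_borel \<longleftrightarrow> (\<lambda>x. indicator csphere x *\<^sub>R f x) \<in> borel_measurable borel"
  unfolding sphere_borel_def by (rule borel_measurable_restrict_space_iff) simp

lemma continuous_on_csphere:
  fixes g :: "complex ^ 'd::finite \<Rightarrow> complex"
  assumes "continuous_on csphere g"
  shows "g \<in> borel_measurable sphere_borel" "\<exists>C. \<forall>x\<in>csphere. norm (g x) \<le> C"
proof -
  show "g \<in> borel_measurable sphere_borel"
    unfolding sphere_borel_def by (rule borel_measurable_continuous_on_restrict[OF assms])
  have "bounded (g ` csphere)"
    by (intro compact_imp_bounded compact_continuous_image assms compact_sphere)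
  then show "\<exists>C. \<forall>x\<in>csphere. norm (g x) \<le> C"
    by (simp add: bounded_iff)
qed

lemma proj_map_in_proj_space:
  assumes "x \<in> csphere"
  shows "proj_map x \<in> proj_space"
proof -
  have "x \<noteq> 0" using assms by auto
  then show ?thesis
    by (simp add: proj_map_def proj_space_def vec.dim_span vec.dim_singleton)
qed

lemma measurable_proj_map: "proj_map \<in> measurable sphere_borel proj_borel"
  unfolding proj_borel_def
proof (rule measurable_measure_of)
  fix U :: "(complex ^ 'd) set set"
  assume "U \<in> {U. U \<subseteq> proj_space \<and> openin (top_of_set csphere) {x \<in> csphere. proj_map x \<in> U}}"
  then have "\<exists>T. open T \<and> {x \<in> csphere. proj_map x \<in> U} = csphere \<inter> T"
    by (simp only: openin_open mem_Collect_eq)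
  then obtain T where T: "open T" "{x \<in> csphere. proj_map x \<in> U} = csphere \<inter> T"
    by (elim exE conjE)
  have "proj_map -` U \<inter> space sphere_borel = {x \<in> csphere. proj_map x \<in> U}"
    unfolding space_sphere_borel by blast
  also have "\<dots> = T \<inter> csphere"
    unfolding T(2) by (rule Int_commute)
  finally have "proj_map -` U \<inter> space sphere_borel = T \<inter> csphere" .
  then show "proj_map -` U \<inter> space sphere_borel \<in> sets sphere_borel"
    using T(1) by (simp add: sets_sphere_borel_Int)
qed (use proj_map_in_proj_space in auto)

text \<open>Off the support every point has a null neighbourhood, but there may be uncountably many
  of these. The Lindelof property extracts countably many with the same union.\<close>

lemma AE_in_cm_support:
  fixes \<nu> :: "(complex ^ 'd::finite) set \<Rightarrow> complex"
  shows "AE x in variation sphere_borel \<nu>. x \<in> cm_support \<nu>"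
proof -
  let ?V = "variation sphere_borel \<nu>"
  define F where "F = {U :: (complex ^ 'd) set. open U \<and> emeasure ?V (csphere \<inter> U) = 0}"
  have "open U" if "U \<in> F" for U
    using that by (simp add: F_def)
  then obtain F' where F': "F' \<subseteq> F" "countable F'" "\<Union>F' = \<Union>F"
    using Lindelof[of F] by metis
  have "csphere \<inter> U \<in> null_sets ?V" if "U \<in> F'" for U
  proof -
    have "U \<in> F" using that F'(1) by (rule subsetD[rotated])
    then have "open U" "emeasure ?V (csphere \<inter> U) = 0" by (simp_all add: F_def)
    moreover have "csphere \<inter> U \<in> sets sphere_borel"
      using sets_sphere_borel_Int[of U] \<open>open U\<close> by (simp add: Int_commute)
    ultimately show ?thesis by (simp add: null_sets_def)
  qed
  then have "(\<Union>U\<in>F'. csphere \<inter> U) \<in> null_sets ?V"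
    by (intro null_sets_UN' F'(2))
  then have "AE x in ?V. x \<notin> (\<Union>U\<in>F'. csphere \<inter> U)"
    by (rule AE_not_in)
  then show ?thesis
    using AE_space
  proof eventually_elim
    case (elim x)
    then have x: "x \<in> csphere" "x \<notin> \<Union>F"
      unfolding F'(3)[symmetric] by simp_all
    then have "emeasure ?V (csphere \<inter> U) \<noteq> 0" if "open U" "x \<in> U" for U
      using that x(2) unfolding F_def by simp metis
    then show ?case using x(1) by (simp add: cm_support_def)
  qed
qed

locale sphere_kernel = complex_kernel "sphere_borel :: (complex ^ 'd::finite) measure" N \<mu> m
  for N :: "'z measure" and \<mu> m +
  assumes continuous: "\<And>g. continuous_on csphere g \<Longrightarrow>
     integrable N (\<lambda>z. cm_integral sphere_borel (m z) g) \<and>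
     cm_integral sphere_borel \<mu> g = (\<integral>z. cm_integral sphere_borel (m z) g \<partial>N)"
begin

lemma decomposes_continuous: "continuous_on csphere g \<Longrightarrow> decomposes g"
  using continuous continuous_on_csphere by (auto simp: decomposes_def)

text \<open>The indicator is the bounded limit of the continuous functions that rise with slope
  \<open>n\<close> in the distance from the complement and are cut off at 1.\<close>

lemma decomposes_open:
  assumes U: "open U"
  shows "decomposes (\<lambda>x. indicator U x)"
\<comment> \<open>The distance to the empty set is 0 by convention, so the approximating functions
  would vanish for the whole space.\<close>
proof (cases "U = UNIV")
  case True
  then show ?thesis
    using decomposes_continuous[of "\<lambda>x. 1"] by simp
next
  case False
  define g where "g n x = complex_of_real (min 1 (real n * infdist x (- U)))" for n x
  show ?thesis
  proof (rule decomposes_lim[where C=1])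
    show "decomposes (g n)" for n
      unfolding g_def by (intro decomposes_continuous continuous_intros)
    show "norm (g n x) \<le> 1" for n x
      unfolding g_def by (simp add: infdist_nonneg min_def)
    show "(\<lambda>n. g n x) \<longlonglongrightarrow> indicator U x" for x
    proof (cases "x \<in> U")
      case True
      have "infdist x (- U) \<noteq> 0"
        using in_closed_iff_infdist_zero[of "- U" x] U False True by auto
      then have pos: "infdist x (- U) > 0"
        using infdist_nonneg[of x "- U"] by linarith
      obtain n0 where n0: "real n0 * infdist x (- U) > 1"
        using reals_Archimedean3[OF pos] by blast
      have "g n x = 1" if "n0 \<le> n" for n
      proof -
        have "real n0 * infdist x (- U) \<le> real n * infdist x (- U)"
          using that pos by (intro mult_right_mono) auto
        then show ?thesis using n0 by (simp add: g_def)
      qed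
      then have "eventually (\<lambda>n. g n x = 1) sequentially"
        by (rule eventually_sequentiallyI)
      then show ?thesis
        using True by (simp add: tendsto_eventually)
    next
      case False
      then show ?thesis by (simp add: g_def)
    qed
  qed
qed

text \<open>Open sets are stable under intersection and generate the Borel sets, so it suffices to
  pass to complements and countable disjoint unions.\<close>

lemma decomposes_indicator:
  assumes "E \<in> sets borel"
  shows "decomposes (\<lambda>x. indicator E x)"
proof -
  have "Int_stable {S :: (complex ^ 'd) set. open S}"
    by (auto simp: Int_stable_def)
  moreover have "{S :: (complex ^ 'd) set. open S} \<subseteq> Pow UNIV"
    by simp
  moreover have "E \<in> sigma_sets UNIV {S. open S}"
    using assms by (simp add: borel_def)
  ultimately show ?thesis
  proof (induction rule: sigma_sets_induct_disjoint)
    case (basic A)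
    then show ?case by (simp add: decomposes_open)
  next
    case empty
    show ?case by (rule decomposes_open) simp
  next
    case (compl A)
    have "decomposes (\<lambda>x. 1 + (- 1) * indicator A x)"
      by (intro decomposes_add decomposes_cmult compl decomposes_continuous continuous_intros)
    moreover have "(\<lambda>x. 1 + (- 1) * indicator A x :: complex) = indicator (UNIV - A)"
      by (auto simp: indicator_def)
    ultimately show ?case by simp
  next
    case (union A)
    show ?case
    proof (rule decomposes_lim[where C=1])
      \<comment> \<open>\<open>Suc n\<close> instead of \<open>n\<close> keeps the index set
        nonempty, as \<open>decomposes_sum\<close> demands.\<close>
      show "(\<lambda>n. indicator (\<Union>i<Suc n. A i) x) \<longlonglongrightarrow> (indicator (\<Union>i. A i) x :: complex)" for x
        by (rule LIMSEQ_Suc[OF LIMSEQ_indicator_UN])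
      fix n
      have "indicator (\<Union>i<Suc n. A i) x = (\<Sum>i<Suc n. indicator (A i) x :: complex)" for x
        by (rule indicator_UN_disjoint)
          (use union(1) in \<open>auto simp: disjoint_family_on_def\<close>)
      moreover have "decomposes (\<lambda>x. \<Sum>i<Suc n. indicator (A i) x :: complex)"
        by (rule decomposes_sum) (use union in auto)
      ultimately show "decomposes (\<lambda>x. indicator (\<Union>i<Suc n. A i) x)" by simp
    qed (simp add: indicator_def)
  qed
qed

lemma decomposes_bounded:
  assumes G: "G \<in> borel_measurable sphere_borel" and C: "\<And>x. x \<in> csphere \<Longrightarrow> norm (G x) \<le> C"
  shows "decomposes G"
proof -
  \<comment> \<open>Extension by 0 off the sphere makes the function Borel on the whole space, so
    that the level sets of the approximating simple functions are Borel sets there.\<close>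
  define G' where "G' x = indicator csphere x *\<^sub>R G x" for x
  have G': "G' \<in> borel_measurable borel"
    using G unfolding G'_def borel_measurable_sphere_borel_iff .
  obtain F where F: "\<And>i. simple_function borel (F i)" "\<And>x. (\<lambda>i. F i x) \<longlonglongrightarrow> G' x"
    "\<And>i x. dist (F i x) 0 \<le> 2 * dist (G' x) 0"
    using borel_measurable_implies_sequence_metric[OF G', of 0] by auto
  show ?thesis
  proof (rule decomposes_lim)
    show "(\<lambda>i. F i x) \<longlonglongrightarrow> G x" if "x \<in> space sphere_borel" for x
      using F(2)[of x] that by (simp add: G'_def)
    \<comment> \<open>The factor 2 comes from the approximation theorem, which bounds the simple
      functions by twice the distance of the limit from 0.\<close>
    show "norm (F i x) \<le> 2 * C" if "x \<in> space sphere_borel" for i x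
      using F(3)[of i x] C[of x] that by (simp add: G'_def)
    fix i
    have fin: "finite (range (F i))" and meas: "\<And>y. y \<in> range (F i) \<Longrightarrow> F i -` {y} \<in> sets borel"
      using F(1)[of i] by (auto simp: simple_function_def)
    have "decomposes (\<lambda>x. \<Sum>y\<in>range (F i). y * indicator (F i -` {y}) x)"
      by (intro decomposes_sum decomposes_cmult decomposes_indicator meas fin) auto
    moreover have "(\<Sum>y\<in>range (F i). y * indicator (F i -` {y}) x) = F i x" for x
    proof -
      have "(\<Sum>y\<in>range (F i). y * indicator (F i -` {y}) x) = (\<Sum>y\<in>range (F i). if y = F i x then y else 0)"
        by (intro sum.cong) (simp_all add: indicator_def)
      also have "\<dots> = F i x"
        using fin by simp
      finally show ?thesis .
    qed
    ultimately show "decomposes (F i)" by simp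
  qed
qed

end

subsection \<open>Disintegration of the total variation\<close>

lemma AE_variation_zero: "AE x in variation M (\<lambda>_. 0). P x"
proof -
  have "variation M (\<lambda>_. 0) = density (null_measure M) (\<lambda>x. ennreal (norm (0::complex)))"
  proof (rule variation_density)
    show "finite_measure (null_measure M)" by (rule finite_measureI) simp
  qed (simp_all add: set_lebesgue_integral_def)
  then have "emeasure (variation M (\<lambda>_. 0)) (space M) = 0"
    by simp
  then show ?thesis by (intro AE_I[of _ _ "space M"]) auto
qed

lemma borel_measurable_cnj [measurable (raw)]:
  "f \<in> borel_measurable M \<Longrightarrow> (\<lambda>x. cnj (f x)) \<in> borel_measurable M"
  by (rule borel_measurable_continuous_on[of cnj]) (intro continuous_intros)

text \<open>As \<open>H\<close> is a polar density of modulus 1, \<open>cnj H\<close> cancels it.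
  This writes the total variation of \<open>A\<close> as the integral of a test function that is the
  same for all measures sharing the polar density \<open>H\<close>.\<close>

lemma cm_integral_indicator_cnj:
  assumes \<nu>: "complex_measure M \<nu>" and H: "AE x in variation M \<nu>. polar_density M \<nu> x = H x"
    and H'[measurable]: "H \<in> borel_measurable M" and A[measurable]: "A \<in> sets M"
  shows "cm_integral M \<nu> (\<lambda>x. indicator A x * cnj (H x)) = of_real (measure (variation M \<nu>) A)"
proof -
  have [measurable]: "polar_density M \<nu> \<in> borel_measurable M" by (rule polar_density_measurable[OF \<nu>])
  have "AE x in variation M \<nu>. indicator A x * cnj (H x) * polar_density M \<nu> x = of_real (indicator A x)"
    using H AE_space
  proof eventually_elim
    case (elim x)
    then have "norm (H x) = 1"
      using norm_polar_density[OF \<nu>, of x] by simp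
    then have "H x * cnj (H x) = 1"
      using complex_norm_square[of "H x"] by simp
    then show ?case
      using elim(1) by (simp add: indicator_def mult.commute)
  qed
  then have "cm_integral M \<nu> (\<lambda>x. indicator A x * cnj (H x)) = (\<integral>x. complex_of_real (indicator A x) \<partial>variation M \<nu>)"
    unfolding cm_integral_def by (intro integral_cong_AE) auto
  also have "\<dots> = of_real (measure (variation M \<nu>) A)"
    by simp
  finally show ?thesis .
qed

lemma AE_polar_density_fibres:
  fixes \<sigma> :: "(complex ^ 'd::finite) set measure"
  assumes "sphere_kernel (completion \<sigma>) \<mu> m" and \<sigma>: "sets \<sigma> = sets proj_borel"
    and fib: "\<And>\<zeta>. AE x in variation sphere_borel (m \<zeta>). proj_map x = \<zeta>"
  shows "AE \<zeta> in \<sigma>. AE x in variation sphere_borel (m \<zeta>).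
    polar_density sphere_borel (m \<zeta>) x = polar_density sphere_borel \<mu> x"
proof -
  interpret sphere_kernel "completion \<sigma>" \<mu> m by fact
  let ?S = "sphere_borel :: (complex ^ 'd) measure"
  let ?N = "completion \<sigma>"
  define H where "H = polar_density ?S \<mu>"
  have H[measurable]: "H \<in> borel_measurable ?S"
    unfolding H_def by (rule polar_density_measurable[OF \<mu>])
  have H1: "norm (H x) = 1" if "x \<in> csphere" for x
    unfolding H_def using norm_polar_density[OF \<mu>, of x] that by simp
  define g where "g A x = indicator A x * cnj (H x)" for A x
  have gm: "g A \<in> borel_measurable ?S" if "A \<in> sets ?S" for A
    unfolding g_def using that by measurable
  have dec: "decomposes (g A)" if "A \<in> sets ?S" for A
    by (rule decomposes_bounded[OF gm[OF that], of 1])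
      (simp add: g_def norm_mult H1 indicator_def)
  define F where "F A \<zeta> = cm_integral ?S (m \<zeta>) (g A)" for A \<zeta>
  have Fint: "integrable ?N (F A)" if "A \<in> sets ?S" for A
    using dec[OF that] unfolding decomposes_def F_def by simp
  have pos: "AE \<zeta> in ?N. 0 \<le> Re (F A \<zeta>) \<and> Im (F A \<zeta>) = 0" if A: "A \<in> sets ?S" for A
  proof (rule AE_nonneg_complex_of_set_integral[OF Fint[OF A]])
    fix E assume E: "E \<in> sets ?N"
    \<comment> \<open>\<open>E\<close> lies only in the completed \<sigma>-algebra, where its
      preimage on the sphere may fail to be measurable. It is replaced by a set of the original
      \<sigma>-algebra that differs from it by a null set.\<close>
    define B where "B = main_part \<sigma> E"
    have B: "B \<in> sets proj_borel"
      unfolding B_def using main_part_sets[OF E] \<sigma> by simp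
    have B': "B \<in> sets ?N" using B \<sigma> by auto
    define A' where "A' = (proj_map -` B \<inter> space ?S) \<inter> A"
    have A': "A' \<in> sets ?S"
      unfolding A'_def by (intro sets.Int A measurable_sets[OF measurable_proj_map B])
    \<comment> \<open>On the fibre over \<zeta>, membership of \<open>proj_map x\<close> in
      \<open>B\<close> is just membership of \<zeta>, so that factor of the test function comes out
      of the integral. This localises an identity about \<mu> to sets of \<zeta>.\<close>
    have gA': "F A' \<zeta> = indicator B \<zeta> *\<^sub>R F A \<zeta>" for \<zeta>
    proof -
      note [measurable] = gm[OF A] gm[OF A'] polar_density_measurable[OF m[of \<zeta>]]
      have "AE x in variation ?S (m \<zeta>). g A' x * polar_density ?S (m \<zeta>) x
          = indicator B \<zeta> *\<^sub>R (g A x * polar_density ?S (m \<zeta>) x)"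
        using fib[of \<zeta>] AE_space
        by eventually_elim (simp add: g_def A'_def indicator_def)
      then have "F A' \<zeta> = (\<integral>x. indicator B \<zeta> *\<^sub>R (g A x * polar_density ?S (m \<zeta>) x) \<partial>variation ?S (m \<zeta>))"
        unfolding F_def cm_integral_def by (intro integral_cong_AE) auto
      then show ?thesis
        unfolding F_def cm_integral_def by simp
    qed
    have [measurable]: "F A \<in> borel_measurable ?N"
      using Fint[OF A] by auto
    have "AE \<zeta> in ?N. \<zeta> \<in> B \<longleftrightarrow> \<zeta> \<in> E"
      unfolding B_def by (rule AE_completion[OF AE_in_main_part[OF E]])
    then have "AE \<zeta> in ?N. indicator E \<zeta> *\<^sub>R F A \<zeta> = indicator B \<zeta> *\<^sub>R F A \<zeta>"
      by eventually_elim (simp add: indicator_def)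
    then have "set_lebesgue_integral ?N E (F A) = (\<integral>\<zeta>. F A' \<zeta> \<partial>?N)"
      unfolding set_lebesgue_integral_def gA' using E B' by (intro integral_cong_AE) auto
    also have "\<dots> = cm_integral ?S \<mu> (g A')"
      using dec[OF A'] by (simp add: decomposes_def F_def)
    also have "\<dots> = of_real (measure (variation ?S \<mu>) A')"
      unfolding g_def by (rule cm_integral_indicator_cnj[OF \<mu> _ H A']) (simp add: H_def)
    finally show "0 \<le> Re (set_lebesgue_integral ?N E (F A)) \<and> Im (set_lebesgue_integral ?N E (F A)) = 0"
      by simp
  qed
  obtain Bs :: "(complex ^ 'd) set set" where Bs: "countable Bs" "topological_basis Bs"
    using ex_countable_basis by metis
  \<comment> \<open>Only because there are countably many such \<open>Fs\<close> can the null sets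
    be merged into one.\<close>
  have cnt: "countable {Fs. finite Fs \<and> Fs \<subseteq> Bs}"
    by (rule countable_Collect_finite_subset[OF Bs(1)])
  have Un_borel: "\<Union>Fs \<in> sets borel" if "Fs \<subseteq> Bs" for Fs
    using that topological_basis_open[OF Bs(2)] by (intro borel_open open_Union) auto
  have "AE \<zeta> in ?N. \<forall>Fs\<in>{Fs. finite Fs \<and> Fs \<subseteq> Bs}.
      0 \<le> Re (F (\<Union>Fs \<inter> csphere) \<zeta>) \<and> Im (F (\<Union>Fs \<inter> csphere) \<zeta>) = 0"
    unfolding AE_ball_countable[OF cnt]
    by (intro ballI pos sets_sphere_borel_Int Un_borel) simp
  then have "AE \<zeta> in \<sigma>. \<forall>Fs\<in>{Fs. finite Fs \<and> Fs \<subseteq> Bs}.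
      0 \<le> Re (F (\<Union>Fs \<inter> csphere) \<zeta>) \<and> Im (F (\<Union>Fs \<inter> csphere) \<zeta>) = 0"
    unfolding AE_completion_iff .
  then show ?thesis
  proof eventually_elim
    case (elim \<zeta>)
    let ?V = "variation ?S (m \<zeta>)" and ?p = "polar_density ?S (m \<zeta>)"
    interpret V: finite_measure ?V by (rule finite_measure_variation[OF m])
    have [measurable]: "?p \<in> borel_measurable ?S"
      by (rule polar_density_measurable[OF m])
    have p1: "norm (?p x) = 1" if "x \<in> csphere" for x
      using norm_polar_density[OF m, of x \<zeta>] that by simp
    \<comment> \<open>Extended by 0 and paired with the image measure on the whole space, so that
      the basis criterion for Polish spaces applies.\<close>
    define q where "q x = indicator csphere x *\<^sub>R (cnj (H x) * ?p x)" for x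
    have "(\<lambda>x. cnj (H x) * ?p x) \<in> borel_measurable ?S" by measurable
    then have q[measurable]: "q \<in> borel_measurable borel"
      unfolding q_def borel_measurable_sphere_borel_iff .
    have id: "(\<lambda>x. x) \<in> measurable ?V borel"
      using borel_measurable_sphere_borel[of "\<lambda>x. x"] by (simp cong: measurable_cong_sets)
    define L where "L = distr ?V borel (\<lambda>x. x)"
    have sL: "sets L = sets borel" by (simp add: L_def)
    have L: "finite_measure L"
      unfolding L_def by (rule V.finite_measure_distr[OF id])
    have q1: "norm (q x) \<le> 1" for x
      by (simp add: q_def indicator_def norm_mult H1 p1)
    have qL: "integrable L q"
      by (rule finite_measure.integrable_const_bound[OF L, of _ 1]) (use q q1 sL in \<open>simp_all cong: measurable_cong_sets\<close>)
    have qE: "set_lebesgue_integral L E q = F (E \<inter> csphere) \<zeta>" if E[measurable]: "E \<in> sets borel" for E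
    proof -
      have "set_lebesgue_integral L E q = (\<integral>x. indicator E x *\<^sub>R q x \<partial>?V)"
        unfolding set_lebesgue_integral_def L_def by (rule integral_distr[OF id]) measurable
      also have "\<dots> = F (E \<inter> csphere) \<zeta>"
        unfolding F_def cm_integral_def
        by (intro Bochner_Integration.integral_cong) (simp_all add: q_def g_def indicator_def)
      finally show ?thesis .
    qed
    have "AE x in L. 0 \<le> Re (q x) \<and> Im (q x) = 0"
    proof (rule AE_nonneg_of_basis[OF L sL qL q1 Bs])
      fix Fs assume "finite Fs" "Fs \<subseteq> Bs"
      then show "0 \<le> Re (set_lebesgue_integral L (\<Union>Fs) q) \<and> Im (set_lebesgue_integral L (\<Union>Fs) q) = 0"
        using elim by (simp add: qE[OF Un_borel])
    qed
    then have "AE x in ?V. 0 \<le> Re (q x) \<and> Im (q x) = 0"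
      unfolding L_def by (rule AE_distrD[OF id])
    then show ?case
      using AE_space
    proof eventually_elim
      case (elim x)
      then have x: "x \<in> csphere" by simp
      have "norm (q x) = 1" using x by (simp add: q_def norm_mult H1 p1)
      \<comment> \<open>A nonnegative real number of modulus 1 is 1; multiplying by
        \<open>H x\<close> then identifies the two polar densities.\<close>
      then have "Re (q x) = 1" "Im (q x) = 0"
        using elim by (simp_all add: cmod_eq_Re)
      then have "cnj (H x) * ?p x = 1"
        using x by (simp add: q_def complex_eq_iff)
      moreover have "H x * cnj (H x) = 1"
        using complex_norm_square[of "H x"] H1[OF x] by simp
      ultimately have "?p x = H x"
        by (metis mult.assoc mult.left_neutral mult.right_neutral)
      then show ?case by (simp add: H_def)
    qed
  qed
qed

text \<open>Where \<open>H\<close> is a polar density of the fibre measure, the total variation of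
  \<open>A\<close> is the integral of one fixed bounded test function. The extended weak
  decomposition applied to that function yields both the measurability of the kernel and the mixture
  formula.\<close>

lemma decomposition_disintegration:
  fixes \<sigma> :: "(complex ^ 'd::finite) set measure"
  assumes \<sigma>: "sets \<sigma> = sets proj_borel" and \<mu>: "complex_measure sphere_borel \<mu>"
    and dec: "decomposition \<sigma> \<mu> m"
  obtains K where "disintegration sphere_borel (variation sphere_borel \<mu>) (completion \<sigma>) K"
    "AE \<zeta> in \<sigma>. complex_measure sphere_borel (m \<zeta>) \<and> K \<zeta> = variation sphere_borel (m \<zeta>) \<and>
       (AE x in K \<zeta>. polar_density sphere_borel (m \<zeta>) x = polar_density sphere_borel \<mu> x)"
proof -
  let ?S = "sphere_borel :: (complex ^ 'd) measure"
  let ?N = "completion \<sigma>"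
  define good where "good \<zeta> \<longleftrightarrow> m \<zeta> \<in> sphere_measures \<and> cm_support (m \<zeta>) \<subseteq> {x \<in> csphere. proj_map x = \<zeta>}" for \<zeta>
  \<comment> \<open>The zero measure satisfies the fibre condition vacuously, so \<open>m'\<close>
    meets it at every \<zeta>, while integrals over \<zeta> are unchanged.\<close>
  define m' where "m' \<zeta> = (if good \<zeta> then m \<zeta> else (\<lambda>_. 0))" for \<zeta>
  have "AE \<zeta> in \<sigma>. good \<zeta>"
    using dec by (simp add: decomposition_def good_def)
  then have eq: "AE \<zeta> in \<sigma>. m \<zeta> = m' \<zeta> \<and> good \<zeta>"
    by eventually_elim (simp add: m'_def)
  have m': "complex_measure ?S (m' \<zeta>)" for \<zeta>
    by (simp add: m'_def good_def sphere_measures_def complex_measure_def)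
  have fib: "AE x in variation ?S (m' \<zeta>). proj_map x = \<zeta>" for \<zeta>
  proof (cases "good \<zeta>")
    case True
    then have sub: "cm_support (m' \<zeta>) \<subseteq> {x \<in> csphere. proj_map x = \<zeta>}"
      by (simp add: m'_def good_def)
    show ?thesis
      using AE_in_cm_support by eventually_elim (use sub in auto)
  next
    case False
    then have "m' \<zeta> = (\<lambda>_. 0)" by (simp add: m'_def)
    then show ?thesis by (simp only: AE_variation_zero)
  qed
  have "AE \<zeta> in \<sigma>. variation_norm ?S (m \<zeta>) = variation_norm ?S (m' \<zeta>)"
    using eq by eventually_elim simp
  moreover have "integrable ?N (\<lambda>\<zeta>. variation_norm ?S (m \<zeta>))"
    using dec by (simp add: decomposition_def)
  ultimately have int: "integrable ?N (\<lambda>\<zeta>. variation_norm ?S (m' \<zeta>))"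
    by (rule integral_completion_cong_AE(1)[rotated])
  have cont: "integrable ?N (\<lambda>\<zeta>. cm_integral ?S (m' \<zeta>) g) \<and>
      cm_integral ?S \<mu> g = (\<integral>\<zeta>. cm_integral ?S (m' \<zeta>) g \<partial>?N)" if g: "continuous_on csphere g" for g
  proof -
    have i: "integrable ?N (\<lambda>\<zeta>. cm_integral ?S (m \<zeta>) g)"
      "cm_integral ?S \<mu> g = (\<integral>\<zeta>. cm_integral ?S (m \<zeta>) g \<partial>?N)"
      using dec g by (simp_all add: decomposition_def weak_decomposition_def)
    have "AE \<zeta> in \<sigma>. cm_integral ?S (m \<zeta>) g = cm_integral ?S (m' \<zeta>) g"
      using eq by eventually_elim simp
    note c = integral_completion_cong_AE[OF i(1) this]
    show ?thesis
      by (intro conjI c(1)) (simp only: i(2) c(2))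
  qed
  have sk: "sphere_kernel ?N \<mu> m'"
    by unfold_locales (use \<mu> m' int cont in simp_all)
  interpret sphere_kernel ?N \<mu> m' by (rule sk)
  define H where "H = polar_density ?S \<mu>"
  have H: "H \<in> borel_measurable ?S"
    unfolding H_def by (rule polar_density_measurable[OF \<mu>])
  define good' where "good' \<zeta> \<longleftrightarrow> (AE x in variation ?S (m' \<zeta>). polar_density ?S (m' \<zeta>) x = H x)" for \<zeta>
  have good': "AE \<zeta> in \<sigma>. good' \<zeta>"
    unfolding good'_def H_def by (rule AE_polar_density_fibres[OF sk \<sigma> fib])
  \<comment> \<open>Almost every \<zeta> satisfies \<open>good'\<close>; over the completion the
    value elsewhere affects neither measurability nor integrals.\<close>
  define K where "K \<zeta> = (if good' \<zeta> then variation ?S (m' \<zeta>) else null_measure ?S)" for \<zeta>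
  show ?thesis
  proof (rule that)
    show "disintegration ?S (variation ?S \<mu>) ?N K"
    proof
      show "sets (variation ?S \<mu>) = sets ?S" "\<And>\<zeta>. sets (K \<zeta>) = sets ?S"
        by (simp_all add: K_def)
      fix A assume A: "A \<in> sets ?S"
      define g where "g x = indicator A x * cnj (H x)" for x
      have "decomposes g"
      proof (rule decomposes_bounded)
        show "g \<in> borel_measurable ?S" unfolding g_def using A H by measurable
        show "norm (g x) \<le> 1" if "x \<in> csphere" for x
          using norm_polar_density[OF \<mu>, of x] that
          by (simp add: g_def norm_mult indicator_def H_def)
      qed
      then have I: "integrable ?N (\<lambda>\<zeta>. cm_integral ?S (m' \<zeta>) g)"
        and E: "cm_integral ?S \<mu> g = (\<integral>\<zeta>. cm_integral ?S (m' \<zeta>) g \<partial>?N)"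
        by (simp_all add: decomposes_def)
      have ReI: "integrable ?N (\<lambda>\<zeta>. Re (cm_integral ?S (m' \<zeta>) g))"
        using I by simp
      have fibre: "cm_integral ?S (m' \<zeta>) g = of_real (measure (variation ?S (m' \<zeta>)) A)" if "good' \<zeta>" for \<zeta>
        unfolding g_def by (rule cm_integral_indicator_cnj[OF m' _ H A]) (use that in \<open>simp add: good'_def\<close>)
      have em: "emeasure (K \<zeta>) A = ennreal (Re (cm_integral ?S (m' \<zeta>) g))" if "good' \<zeta>" for \<zeta>
      proof -
        interpret V: finite_measure "variation ?S (m' \<zeta>)" by (rule finite_measure_variation[OF m'])
        show ?thesis using that by (simp add: K_def fibre V.emeasure_eq_measure)
      qed
      have aeem: "AE \<zeta> in \<sigma>. ennreal (Re (cm_integral ?S (m' \<zeta>) g)) = emeasure (K \<zeta>) A"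
        using good' by eventually_elim (simp add: em)
      show "(\<lambda>\<zeta>. emeasure (K \<zeta>) A) \<in> borel_measurable ?N"
        by (rule borel_measurable_completion_AE[OF _ aeem]) (use ReI in measurable)
      have "AE \<zeta> in \<sigma>. 0 \<le> Re (cm_integral ?S (m' \<zeta>) g)"
        using good' by eventually_elim (simp add: fibre)
      then have nn: "AE \<zeta> in ?N. 0 \<le> Re (cm_integral ?S (m' \<zeta>) g)"
        by (rule AE_completion)
      interpret V: finite_measure "variation ?S \<mu>" by (rule finite_measure_variation[OF \<mu>])
      have "cm_integral ?S \<mu> g = of_real (measure (variation ?S \<mu>) A)"
        unfolding g_def by (rule cm_integral_indicator_cnj[OF \<mu> _ H A]) (simp add: H_def)
      then have "measure (variation ?S \<mu>) A = Re (\<integral>\<zeta>. cm_integral ?S (m' \<zeta>) g \<partial>?N)"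
        using E by (metis Re_complex_of_real)
      also have "\<dots> = (\<integral>\<zeta>. Re (cm_integral ?S (m' \<zeta>) g) \<partial>?N)"
        using I by simp
      finally have "emeasure (variation ?S \<mu>) A = ennreal (\<integral>\<zeta>. Re (cm_integral ?S (m' \<zeta>) g) \<partial>?N)"
        by (simp add: V.emeasure_eq_measure)
      also have "\<dots> = (\<integral>\<^sup>+ \<zeta>. ennreal (Re (cm_integral ?S (m' \<zeta>) g)) \<partial>?N)"
        by (rule nn_integral_eq_integral[OF ReI nn, symmetric])
      also have "\<dots> = (\<integral>\<^sup>+ \<zeta>. emeasure (K \<zeta>) A \<partial>?N)"
        by (rule nn_integral_cong_AE[OF AE_completion[OF aeem]])
      finally show "emeasure (variation ?S \<mu>) A = (\<integral>\<^sup>+ \<zeta>. emeasure (K \<zeta>) A \<partial>?N)" .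
    qed
    show "AE \<zeta> in \<sigma>. complex_measure ?S (m \<zeta>) \<and> K \<zeta> = variation ?S (m \<zeta>) \<and>
       (AE x in K \<zeta>. polar_density ?S (m \<zeta>) x = polar_density ?S \<mu> x)"
      using eq good'
    proof eventually_elim
      case (elim \<zeta>)
      then have mm: "m \<zeta> = m' \<zeta>" by simp
      have KV: "K \<zeta> = variation ?S (m \<zeta>)" using elim by (simp add: K_def)
      have "complex_measure ?S (m \<zeta>)" unfolding mm by (rule m')
      moreover have "AE x in variation ?S (m \<zeta>). polar_density ?S (m \<zeta>) x = H x"
        using elim(2) unfolding mm good'_def .
      ultimately show ?case
        unfolding KV H_def[symmetric] by (intro conjI refl)
    qed
  qed
qed

section \<open>Decomposition of the measure with density \<open>f\<close>\<close>

theorem theorem2p8: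
  fixes \<sigma> :: "(complex ^ 'd::finite) set measure"
    and \<mu> :: "(complex ^ 'd) set \<Rightarrow> complex"
    and m :: "(complex ^ 'd) set \<Rightarrow> (complex ^ 'd) set \<Rightarrow> complex"
    and f :: "complex ^ 'd \<Rightarrow> complex"
  assumes "invariant_proj_prob \<sigma>"
    and "\<mu> \<in> sphere_measures"
    and "decomposition \<sigma> \<mu> m"
    and "integrable (variation sphere_borel \<mu>) f"
  shows "decomposable \<sigma> (cm_density sphere_borel f \<mu>) \<and>
         (AE \<zeta> in \<sigma>. integrable (variation sphere_borel (m \<zeta>)) f) \<and>
         weak_decomposition \<sigma> (cm_density sphere_borel f \<mu>) (\<lambda>\<zeta>. cm_density sphere_borel f (m \<zeta>))"
proof -
  let ?S = "sphere_borel :: (complex ^ 'd) measure"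
  let ?N = "completion \<sigma>"
  let ?H = "polar_density ?S \<mu>"
  have \<sigma>: "sets \<sigma> = sets proj_borel"
    using assms(1) unfolding invariant_proj_prob_def by (rule conjunct1)
  have \<mu>: "complex_measure ?S \<mu>"
    using assms(2) by (simp add: sphere_measures_def)
  obtain K where K: "disintegration ?S (variation ?S \<mu>) ?N K"
    and KV: "AE \<zeta> in \<sigma>. complex_measure ?S (m \<zeta>) \<and> K \<zeta> = variation ?S (m \<zeta>) \<and>
       (AE x in K \<zeta>. polar_density ?S (m \<zeta>) x = ?H x)"
    by (rule decomposition_disintegration[OF \<sigma> \<mu> assms(3)]) (rule that)
  interpret disintegration ?S "variation ?S \<mu>" ?N K by (rule K)
  have f: "f \<in> borel_measurable ?S"
    using assms(4) by (auto dest: borel_measurable_integrable cong: measurable_cong_sets)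
  have H: "?H \<in> borel_measurable ?S"
    by (rule polar_density_measurable[OF \<mu>])
  have "AE \<zeta> in \<sigma>. integrable (K \<zeta>) f"
    using kernel_integral_complex(1)[OF assms(4)] by (simp only: AE_completion_iff)
  with KV have ae: "AE \<zeta> in \<sigma>. complex_measure ?S (m \<zeta>) \<and> K \<zeta> = variation ?S (m \<zeta>) \<and>
      (AE x in K \<zeta>. polar_density ?S (m \<zeta>) x = ?H x) \<and> integrable (variation ?S (m \<zeta>)) f"
    by eventually_elim simp
  have fm: "AE \<zeta> in \<sigma>. integrable (variation ?S (m \<zeta>)) f"
    using ae by eventually_elim simp
  have weak: "weak_decomposition \<sigma> (cm_density ?S f \<mu>) (\<lambda>\<zeta>. cm_density ?S f (m \<zeta>))"
    unfolding weak_decomposition_def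
  proof (intro allI impI)
    fix g :: "complex ^ 'd \<Rightarrow> complex" assume "continuous_on csphere g"
    note g = continuous_on_csphere[OF this]
    obtain C where C: "\<And>x. x \<in> csphere \<Longrightarrow> norm (g x) \<le> C"
      using g(2) by blast
    \<comment> \<open>As \<open>f\<close> may be unbounded, the extension to bounded test functions
      does not reach \<open>g x * f x\<close>. Including the common polar density \<open>?H\<close>
      turns the claim into Fubini for the positive kernel \<open>K\<close>.\<close>
    let ?F = "\<lambda>x. g x * f x * ?H x"
    have F: "integrable (variation ?S \<mu>) ?F"
    proof (rule Bochner_Integration.integrable_bound)
      show "integrable (variation ?S \<mu>) (\<lambda>x. of_real C * f x)"
        using assms(4) by simp
      show "?F \<in> borel_measurable (variation ?S \<mu>)"
        using f g(1) H by measurable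
      show "AE x in variation ?S \<mu>. norm (?F x) \<le> norm (of_real C * f x)"
      proof (rule AE_I2)
        fix x assume "x \<in> space (variation ?S \<mu>)"
        then have x: "x \<in> csphere" by simp
        have "norm (g x) \<le> \<bar>C\<bar>" using C[OF x] by linarith
        then show "norm (?F x) \<le> norm (of_real C * f x)"
          using norm_polar_density[OF \<mu>, of x] x by (simp add: norm_mult mult_right_mono)
      qed
    qed
    have eq: "AE \<zeta> in \<sigma>. (\<integral>x. ?F x \<partial>K \<zeta>) = cm_integral ?S (cm_density ?S f (m \<zeta>)) g"
      using ae
    proof eventually_elim
      case (elim \<zeta>)
      then have m: "complex_measure ?S (m \<zeta>)" and KV: "K \<zeta> = variation ?S (m \<zeta>)"
        and fi: "integrable (variation ?S (m \<zeta>)) f" by simp_all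
      have pm: "polar_density ?S (m \<zeta>) \<in> borel_measurable ?S"
        by (rule polar_density_measurable[OF m])
      have "AE x in K \<zeta>. polar_density ?S (m \<zeta>) x = ?H x"
        using elim by simp
      then have aep: "AE x in variation ?S (m \<zeta>). ?F x = g x * f x * polar_density ?S (m \<zeta>) x"
        unfolding KV by eventually_elim simp
      have "(\<integral>x. ?F x \<partial>K \<zeta>) = cm_integral ?S (m \<zeta>) (\<lambda>x. g x * f x)"
        unfolding KV cm_integral_def
        by (rule integral_cong_AE[OF _ _ aep]) (use f g(1) H pm in measurable)
      also have "\<dots> = cm_integral ?S (cm_density ?S f (m \<zeta>)) g"
        by (rule cm_integral_cm_density[OF m fi g(1), symmetric])
      finally show ?case .
    qed
    note * = integral_completion_cong_AE[OF kernel_integral_complex(2)[OF F] eq]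
    have "cm_integral ?S (cm_density ?S f \<mu>) g = (\<integral>x. ?F x \<partial>variation ?S \<mu>)"
      using cm_integral_cm_density[OF \<mu> assms(4) g(1)] by (simp add: cm_integral_def)
    also have "\<dots> = (\<integral>\<zeta>. \<integral>x. ?F x \<partial>K \<zeta> \<partial>?N)"
      by (rule kernel_integral_complex(3)[OF F])
    finally show "integrable ?N (\<lambda>\<zeta>. cm_integral ?S (cm_density ?S f (m \<zeta>)) g) \<and>
        cm_integral ?S (cm_density ?S f \<mu>) g = (\<integral>\<zeta>. cm_integral ?S (cm_density ?S f (m \<zeta>)) g \<partial>?N)"
      using * by simp
  qed
  have "AE \<zeta> in \<sigma>. cm_density ?S f (m \<zeta>) \<in> sphere_measures \<and>
      cm_support (cm_density ?S f (m \<zeta>)) \<subseteq> {x \<in> csphere. proj_map x = \<zeta>}"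
  proof -
    have "AE \<zeta> in \<sigma>. cm_support (m \<zeta>) \<subseteq> {x \<in> csphere. proj_map x = \<zeta>}"
      using assms(3) by (simp add: decomposition_def)
    with ae show ?thesis
    proof eventually_elim
      case (elim \<zeta>)
      then have m: "complex_measure ?S (m \<zeta>)" and fi: "integrable (variation ?S (m \<zeta>)) f"
        by simp_all
      have f': "f \<in> borel_measurable (variation ?S (m \<zeta>))" using fi by auto
      \<comment> \<open>Multiplying by \<open>f\<close> preserves null sets, so the support can only
        shrink and stays in the fibre. Sets outside the \<sigma>-algebra have measure 0 by
        convention, which lets the claim be stated for all \<open>A\<close>.\<close>
      have null: "emeasure (variation ?S (cm_density ?S f (m \<zeta>))) A = 0"
        if A: "emeasure (variation ?S (m \<zeta>)) A = 0" for A
      proof (cases "A \<in> sets ?S")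
        case True
        then have "A \<in> null_sets (variation ?S (m \<zeta>))"
          using A by (simp add: null_sets_def)
        then have "AE x in variation ?S (m \<zeta>). x \<notin> A"
          by (rule AE_not_in)
        then have "A \<in> null_sets (density (variation ?S (m \<zeta>)) (\<lambda>x. ennreal (norm (f x))))"
          using f' True by (subst null_sets_density_iff) auto
        then show ?thesis
          unfolding variation_cm_density[OF m fi] by (simp add: null_sets_def)
      next
        case False
        then show ?thesis by (simp add: emeasure_notin_sets)
      qed
      have "cm_support (cm_density ?S f (m \<zeta>)) \<subseteq> cm_support (m \<zeta>)"
        unfolding cm_support_def using null by fast
      then show ?case
        using elim complex_measure_cm_density[OF m fi] by (auto simp: sphere_measures_def)
    qed
  qed
  moreover have "integrable ?N (\<lambda>\<zeta>. variation_norm ?S (cm_density ?S f (m \<zeta>)))"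
  proof -
    have nf: "integrable (variation ?S \<mu>) (\<lambda>x. norm (f x))" using assms(4) by simp
    \<comment> \<open>The norm of the fibre measure times \<open>f\<close> is the integral of
      \<open>norm f\<close> against its total variation, so integrability over \<zeta> is Fubini for
      \<open>norm f\<close>.\<close>
    have "AE \<zeta> in \<sigma>. (\<integral>x. norm (f x) \<partial>K \<zeta>) = variation_norm ?S (cm_density ?S f (m \<zeta>))"
      using ae
    proof eventually_elim
      case (elim \<zeta>)
      then have m: "complex_measure ?S (m \<zeta>)" and KV: "K \<zeta> = variation ?S (m \<zeta>)"
        and fi: "integrable (variation ?S (m \<zeta>)) f" by simp_all
      let ?V = "variation ?S (m \<zeta>)"
      have "variation_norm ?S (cm_density ?S f (m \<zeta>))
          = (\<integral>x. 1 \<partial>density ?V (\<lambda>x. ennreal (norm (f x))))"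
        unfolding variation_norm_def variation_cm_density[OF m fi] by simp
      also have "\<dots> = (\<integral>x. norm (f x) *\<^sub>R 1 \<partial>?V)"
        by (rule integral_density) (use fi in auto)
      finally show ?case by (simp add: KV)
    qed
    then show ?thesis
      by (rule integral_completion_cong_AE(1)[OF kernel_integral_real(2)[OF nf]])
  qed
  ultimately have "decomposition \<sigma> (cm_density ?S f \<mu>) (\<lambda>\<zeta>. cm_density ?S f (m \<zeta>))"
    using weak by (simp add: decomposition_def)
  moreover have "cm_density ?S f \<mu> \<in> sphere_measures"
    using complex_measure_cm_density[OF \<mu> assms(4)] by (simp add: sphere_measures_def)
  ultimately show ?thesis
    using fm weak unfolding decomposable_def by blast
qed

end
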